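(* Let $\mathcal{H}=\mathbb{R}^d$ with Lebesgue measure $\pi$, where each $h\in\mathbb{R}^d$ is also regarded as a measurable function $h:\mathcal{X}\to[0,1]$ (jointly measurable in $(h,x)$). Let $A:\mathcal{X}^n\to\mathbb{R}^d$ be measurable with hypothesis sensitivity coefficient $c_A$, let $\sigma>0$ with $12nc_A^2\le\sigma^2$, let $Q_{\mathbf{x}}=\mathcal{N}(A(\mathbf{x}),\sigma^2I)$ (Hamiltonian $-\|h-A(\mathbf{x})\|^2/(2\sigma^2)$), let $n>8$ and $\delta>0$. Then with probability at least $1-\delta$ in $\mathbf{X}\sim\mu^n$, for all probability measures $P$ on $\mathcal{H}$, $$\mathbb{E}_{h\sim P}\left[kl(\hat L(h,\mathbf{X}),L(h))\right]\le\frac{2KL(P,Q_{\mathbf{X}})+\frac{6}{\sigma^2}\mathcal{V}(A)+\ln(2\sqrt n)+2\ln(1/\delta)}{n}.$$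
   Context: $\mathcal{X}$ is a measurable space with probability measure $\mu$, $\mathbf{X}=(X_1,\dots,X_n)\sim\mu^n$, $\mathbf{X}'$ an independent copy, $X\sim\mu$. $\|\cdot\|$ is the Euclidean norm. $c_A=\max_{k\in[n]}\sup_{\mathbf{x}\in\mathcal{X}^n,\,y,y'\in\mathcal{X}}\|A(S^k_y\mathbf{x})-A(S^k_{y'}\mathbf{x})\|$, where $S^k_y\mathbf{x}$ replaces the $k$-th coordinate of $\mathbf{x}$ by $y$. $\mathcal{V}(A)=\mathbb{E}\left[\|A(\mathbf{X})-\mathbb{E}[A(\mathbf{X}')]\|^2\right]$. $L(h)=\mathbb{E}[h(X)]$, $\hat L(h,\mathbf{x})=\frac1n\sum_{i=1}^n h(x_i)$. $kl(s,t)=s\ln\frac{s}{t}+(1-s)\ln\frac{1-s}{1-t}$ for $s,t\in[0,1]$. $KL(P,R)=\int\ln\frac{dP}{dR}\,dP$ if $P\ll R$ and $+\infty$ otherwise. *)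

theory Defs
  imports "HOL-Probability.Probability"
begin

abbreviation sample_space :: "nat \<Rightarrow> 'x measure \<Rightarrow> (nat \<Rightarrow> 'x) measure" where
  "sample_space n \<mu> \<equiv> PiM {..<n} (\<lambda>_. \<mu>)"

definition kl_term :: "real \<Rightarrow> real \<Rightarrow> ereal" where
  "kl_term s t = (if s = 0 then 0 else if t = 0 then \<infinity> else ereal (s * ln (s / t)))"

definition kl :: "real \<Rightarrow> real \<Rightarrow> ennreal" where
  "kl s t = e2ennreal (kl_term s t + kl_term (1 - s) (1 - t))"

definition KL_div :: "'a measure \<Rightarrow> 'a measure \<Rightarrow> ereal" where
  "KL_div P R = (if absolutely_continuous R P \<and> integrable P (\<lambda>h. ln (enn2real (RN_deriv R P h)))
     then ereal (\<integral>h. ln (enn2real (RN_deriv R P h)) \<partial>P) else \<infinity>)"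

definition hyp_sens :: "nat \<Rightarrow> 'x measure \<Rightarrow> ((nat \<Rightarrow> 'x) \<Rightarrow> 'h::real_normed_vector) \<Rightarrow> ereal" where
  "hyp_sens n \<mu> A = (SUP k\<in>{..<n}. SUP x\<in>space (sample_space n \<mu>). SUP y\<in>space \<mu>. SUP y'\<in>space \<mu>.
      ereal (norm (A (x(k := y)) - A (x(k := y')))))"

definition alg_var :: "nat \<Rightarrow> 'x measure \<Rightarrow> ((nat \<Rightarrow> 'x) \<Rightarrow> 'h::euclidean_space) \<Rightarrow> real" where
  "alg_var n \<mu> A = (\<integral>x. (norm (A x - (\<integral>x'. A x' \<partial>sample_space n \<mu>)))\<^sup>2 \<partial>sample_space n \<mu>)"

definition risk :: "'x measure \<Rightarrow> ('h \<Rightarrow> 'x \<Rightarrow> real) \<Rightarrow> 'h \<Rightarrow> real" where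
  "risk \<mu> hyp h = (\<integral>x. hyp h x \<partial>\<mu>)"

definition emp_risk :: "nat \<Rightarrow> ('h \<Rightarrow> 'x \<Rightarrow> real) \<Rightarrow> 'h \<Rightarrow> (nat \<Rightarrow> 'x) \<Rightarrow> real" where
  "emp_risk n hyp h xs = (\<Sum>i<n. hyp h (xs i)) / real n"

definition gauss_post :: "real \<Rightarrow> 'h::euclidean_space \<Rightarrow> 'h measure" where
  "gauss_post \<sigma> a = density lborel (\<lambda>h. ennreal ((2 * pi * \<sigma>\<^sup>2) powr (- real DIM('h) / 2)
      * exp (- (norm (h - a))\<^sup>2 / (2 * \<sigma>\<^sup>2))))"

end

theory Submission
  imports Defs
begin

text \<open>
  By the Donsker--Varadhan inequality and Markov's inequality it suffices to bound the expectation
  over the sample of \<open>\<integral> exp (n/2 kl) dQ\<^sub>x\<close>. Comparing \<open>Q\<^sub>x\<close> with the fixed Gaussian \<open>Q\<^sub>0\<close> centred at the mean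
  of \<open>A\<close>, the inequality \<open>2 u w \<le> t v w\<^sup>2 + u\<^sup>2 / (t v)\<close> separates this into \<open>exp (n kl)\<close> under the
  data-independent \<open>Q\<^sub>0\<close> and the chi-square integral \<open>\<integral> q\<^sub>x\<^sup>2 / q\<^sub>0 = exp (\<parallel>A - E A\<parallel>\<^sup>2 / \<sigma>\<^sup>2)\<close>.

  The first has expectation at most \<open>2 \<surd>n\<close>, because the maximal likelihood of a binary word of
  length \<open>n\<close> exceeds its Krichevsky--Trofimov probability by a factor of at most \<open>2 \<surd>n\<close>.
  For the second, \<open>f = \<parallel>A - E A\<parallel>\<^sup>2\<close> is self-bounding: decreasing \<open>f\<close> by changing one coordinate
  changes it by at most \<open>2 c \<surd>f\<close>. Tensorization of entropy then bounds its exponential moment in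
  terms of its mean.
\<close>

section \<open>Exponential moment of the binary relative entropy\<close>

text \<open>The Gaussian posterior depends on the sample, so the expectation over the sample cannot
  be exchanged with integration against it; the fixed Gaussian makes Fubini applicable. The price is
  a square root: once the free weight \<open>t\<close> is optimized, the moment of
  \<open>exp (n/2 * kl)\<close> is bounded by the geometric mean of the two separated moments.

  This explains the coefficients of the final bound. Donsker--Varadhan at scale \<open>n/2\<close>
  doubles the divergence and \<open>ln (1 / \<delta>)\<close>, whereas for
  \<open>ln (2 * sqrt n)\<close> and the variance term the doubling is undone by the square root.

  The comparison with binary words is possible for \<open>[0, 1]\<close>-valued losses because the
  likelihood ratio is a product over coordinates, and each factor is bounded by a function affine in
  its coordinate. Multiplying out then leaves only words of zeros and ones.\<close>

text \<open>The Krichevsky--Trofimov probability of a binary word with \<open>a\<close> ones and \<open>b\<close> zeros, that is,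
  its likelihood averaged over the Beta(1/2, 1/2) distribution of the parameter.\<close>

definition kt :: "nat \<Rightarrow> nat \<Rightarrow> real" where
  "kt a b = (\<Prod>i<a. real i + 1/2) * (\<Prod>i<b. real i + 1/2) / fact (a + b)"

lemma kt_commute: "kt a b = kt b a"
  by (simp add: kt_def add.commute)

lemma kt_pos: "kt a b > 0"
  by (auto simp: kt_def intro!: divide_pos_pos mult_pos_pos prod_pos)

lemma kt_Suc_left: "kt (Suc a) b = kt a b * (real a + 1/2) / real (a + b + 1)"
  by (simp add: kt_def field_simps)

lemma kt_Suc_right: "kt a (Suc b) = kt a b * (real b + 1/2) / real (a + b + 1)"
  by (simp add: kt_def field_simps)

text \<open>The factors \<open>(a + 1/2) / (a + b + 1)\<close> and
  \<open>(b + 1/2) / (a + b + 1)\<close> are the predicted probabilities that the next letter is one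
  or zero, and they add up to one.\<close>

lemma kt_split: "kt (Suc a) b + kt a (Suc b) = kt a b"
  by (simp add: kt_Suc_left kt_Suc_right add_divide_distrib[symmetric] field_simps)

text \<open>A subset stands for a word, its elements being the positions of the ones. Extending a
  fixed word by all words on \<open>I\<close> preserves the total probability; the letter at
  \<open>i\<close> is absorbed into \<open>a\<close> or \<open>b\<close>, which is why both are
  generalized. With \<open>a = b = 0\<close> this says that the mixing weights add up to
  one.\<close>

lemma sum_kt_Pow:
  assumes "finite I"
  shows "(\<Sum>S\<in>Pow I. kt (a + card S) (b + card (I - S))) = kt a b"
  using assms
proof (induction I arbitrary: a b)
  case empty
  then show ?case by simp
next
  case (insert i I)
  have fin: "finite S" if "S \<in> Pow I" for S
    using that insert.hyps(1) by (auto intro: finite_subset)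
  have inj: "inj_on (insert i) (Pow I)"
    using insert.hyps(2) by (auto simp: inj_on_def)
  have "(\<Sum>S\<in>Pow (insert i I). kt (a + card S) (b + card (insert i I - S)))
      = (\<Sum>S\<in>Pow I. kt (a + card S) (b + card (insert i I - S)))
        + (\<Sum>S\<in>insert i ` Pow I. kt (a + card S) (b + card (insert i I - S)))"
    unfolding Pow_insert using insert.hyps by (intro sum.union_disjoint) auto
  also have "(\<Sum>S\<in>Pow I. kt (a + card S) (b + card (insert i I - S)))
      = (\<Sum>S\<in>Pow I. kt (a + card S) (Suc b + card (I - S)))"
  proof (intro sum.cong refl)
    fix S assume S: "S \<in> Pow I"
    then have "insert i I - S = insert i (I - S)" "i \<notin> I - S"
      using insert.hyps by auto
    then show "kt (a + card S) (b + card (insert i I - S)) = kt (a + card S) (Suc b + card (I - S))"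
      using insert.hyps(1) by simp
  qed
  also have "\<dots> = kt a (Suc b)" by (rule insert.IH)
  also have "(\<Sum>S\<in>insert i ` Pow I. kt (a + card S) (b + card (insert i I - S)))
      = (\<Sum>S\<in>Pow I. kt (Suc a + card S) (b + card (I - S)))"
    unfolding sum.reindex[OF inj] comp_def
  proof (intro sum.cong refl)
    fix S assume S: "S \<in> Pow I"
    then have "insert i I - insert i S = I - S" "i \<notin> S"
      using insert.hyps by auto
    then show "kt (a + card (insert i S)) (b + card (insert i I - insert i S))
        = kt (Suc a + card S) (b + card (I - S))"
      using fin[OF S] by simp
  qed
  also have "\<dots> = kt (Suc a) b" by (rule insert.IH)
  finally show ?case using kt_split[of a b] by simp
qed

section \<open>Maximal likelihood of a binary word against its Krichevsky--Trofimov
  probability\<close>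

lemma entropy_pair_le:
  fixes t :: real
  assumes "0 \<le> t" "t < 1"
  shows "(1 + t) * ln (1 + t) - (1 - t) * ln (1 - t) \<le> 2 * t"
proof -
  define f where "f = (\<lambda>t::real. (1 + t) * ln (1 + t) - (1 - t) * ln (1 - t) - 2 * t)"
  have "f t \<le> f 0"
  proof (rule DERIV_nonpos_imp_nonincreasing[OF assms(1)])
    fix x :: real assume x: "0 \<le> x" "x \<le> t"
    have "(f has_real_derivative ln (1 + x) + ln (1 - x)) (at x)"
      unfolding f_def using x assms by (auto intro!: derivative_eq_intros)
    moreover have "ln (1 + x) + ln (1 - x) = ln (1 - x\<^sup>2)"
      using x assms by (subst ln_mult_pos[symmetric]) (auto simp: power2_eq_square algebra_simps)
    moreover have "ln (1 - x\<^sup>2) \<le> 0"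
      using x assms by (simp add: abs_square_less_1 power_le_one)
    ultimately show "\<exists>y. (f has_real_derivative y) (at x) \<and> y \<le> 0" by auto
  qed
  then show ?thesis by (simp add: f_def)
qed

lemma two_t_le_ln:
  fixes t :: real
  assumes "0 \<le> t" "t < 1"
  shows "2 * t \<le> ln (1 + t) - ln (1 - t)"
proof -
  define f where "f = (\<lambda>t::real. ln (1 + t) - ln (1 - t) - 2 * t)"
  have "f 0 \<le> f t"
  proof (rule DERIV_nonneg_imp_nondecreasing[OF assms(1)])
    fix x :: real assume x: "0 \<le> x" "x \<le> t"
    have "(f has_real_derivative 1 / (1 + x) + 1 / (1 - x) - 2) (at x)"
      unfolding f_def using x assms by (auto intro!: derivative_eq_intros)
    moreover have "1 / (1 + x) + 1 / (1 - x) - 2 = 2 * x\<^sup>2 / ((1 + x) * (1 - x))"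
    proof -
      have "1 + x \<noteq> 0" "1 - x \<noteq> 0" using x assms by auto
      then show ?thesis by (simp add: divide_simps) (simp add: power2_eq_square algebra_simps)
    qed
    moreover have "\<dots> \<ge> 0" using x assms by simp
    ultimately show "\<exists>y. (f has_real_derivative y) (at x) \<and> 0 \<le> y" by auto
  qed
  then show ?thesis by (simp add: f_def)
qed

lemma Suc_power_Suc_le_exp:
  "(real a + 1) ^ Suc a \<le> exp 1 * (real a + 1/2) * real a ^ a"
proof (cases "a = 0")
  case True
  then show ?thesis using exp_ge_add_one_self[of 1] by simp
next
  case False
  define r where "r = real a"
  have r: "r > 0" using False by (simp add: r_def)
  \<comment> \<open>This \<open>t\<close> makes \<open>r + 1\<close> and \<open>r\<close> equal to
    \<open>(r + 1/2) * (1 + t)\<close> and \<open>(r + 1/2) * (1 - t)\<close>; expanding about the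
    midpoint is what produces the factor \<open>r + 1/2\<close>. For \<open>a = 0\<close> it would
    be 1, outside the range of \<open>entropy_pair_le\<close>, hence the separate case.\<close>
  define t where "t = 1 / (2 * r + 1)"
  have t: "0 < t" "t < 1" using r by (auto simp: t_def field_simps)
  have 1: "1 + t = (r + 1) / (r + 1/2)" "1 - t = r / (r + 1/2)"
    using r by (auto simp: t_def field_simps)
  have l1: "ln (1 + t) = ln (r + 1) - ln (r + 1/2)" "ln (1 - t) = ln r - ln (r + 1/2)"
    unfolding 1 using r by (simp_all add: ln_divide_pos)
  have "(1 + t) * ln (1 + t) - (1 - t) * ln (1 - t) \<le> 2 * t"
    using t by (intro entropy_pair_le) auto
  then have "(r + 1/2) * ((1 + t) * ln (1 + t) - (1 - t) * ln (1 - t)) \<le> (r + 1/2) * (2 * t)"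
    using r by (intro mult_left_mono) auto
  moreover have "(r + 1/2) * (2 * t) = 1" "(r + 1/2) * (1 + t) = r + 1" "(r + 1/2) * (1 - t) = r"
    using r unfolding 1 by (auto simp: t_def field_simps)
  ultimately have "(r + 1) * ln (1 + t) - r * ln (1 - t) \<le> 1"
    by (metis (no_types, lifting) mult.assoc right_diff_distrib)
  then have "(r + 1) * ln (r + 1) \<le> 1 + ln (r + 1/2) + r * ln r"
    unfolding l1 by (simp add: algebra_simps)
  then have "exp ((r + 1) * ln (r + 1)) \<le> exp (1 + ln (r + 1/2) + r * ln r)"
    by simp
  also have "\<dots> = exp 1 * (r + 1/2) * r powr r"
    using r by (simp add: exp_add powr_def)
  also have "exp ((r + 1) * ln (r + 1)) = (r + 1) powr (r + 1)"
    using r by (simp add: powr_def)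
  also have "\<dots> = (r + 1) ^ Suc a"
    using r powr_realpow[of "r + 1" "Suc a"] by (simp add: r_def add.commute)
  also have "r powr r = r ^ a"
    using r powr_realpow[of r a] by (simp add: r_def)
  finally show ?thesis by (simp add: r_def)
qed

text \<open>With \<open>t = 1 / (2 * n + 1)\<close> the ratio \<open>(n + 1) / n\<close> is
  \<open>(1 + t) / (1 - t)\<close> and \<open>n + 1/2\<close> is \<open>1 / (2 * t)\<close>, so
  \<open>two_t_le_ln\<close> says that \<open>1 + 1/n\<close> to the power \<open>n + 1/2\<close> is
  at least \<open>exp 1\<close>.\<close>

lemma exp_mult_sqrt_power_le:
  assumes "n \<ge> 1"
  shows "exp 1 * sqrt (real n) * real n ^ n \<le> sqrt (real n + 1) * (real n + 1) ^ n"
proof -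
  define r where "r = real n"
  have r: "r > 0" using assms by (simp add: r_def)
  define t where "t = 1 / (2 * r + 1)"
  have t: "0 < t" "t < 1" using r by (auto simp: t_def field_simps)
  have 1: "1 + t = (r + 1) / (r + 1/2)" "1 - t = r / (r + 1/2)"
    using r by (auto simp: t_def field_simps)
  have l1: "ln (1 + t) = ln (r + 1) - ln (r + 1/2)" "ln (1 - t) = ln r - ln (r + 1/2)"
    unfolding 1 using r by (simp_all add: ln_divide_pos)
  have "2 * t \<le> ln (r + 1) - ln r"
    using two_t_le_ln[of t] t l1 by simp
  then have "(r + 1/2) * (2 * t) \<le> (r + 1/2) * (ln (r + 1) - ln r)"
    using r by (intro mult_left_mono) auto
  moreover have "(r + 1/2) * (2 * t) = 1"
    using r by (auto simp: t_def field_simps)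
  ultimately have "1 + (ln r / 2 + r * ln r) \<le> ln (r + 1) / 2 + r * ln (r + 1)"
    by (simp add: algebra_simps)
  then have "exp (1 + (ln r / 2 + r * ln r)) \<le> exp (ln (r + 1) / 2 + r * ln (r + 1))"
    by simp
  moreover have "exp (ln z / 2 + r * ln z) = sqrt z * z ^ n" if "z > 0" for z
  proof -
    have "exp (ln z / 2) = sqrt z"
      using that by (simp add: ln_sqrt[symmetric])
    moreover have "exp (r * ln z) = z ^ n"
      using that powr_realpow[of z n] by (simp add: powr_def r_def)
    ultimately show ?thesis by (simp add: exp_add)
  qed
  ultimately show ?thesis
    using r by (simp add: exp_add r_def mult.assoc)
qed

text \<open>Appending a one multiplies the left side by at most \<open>exp 1 * (a + 1/2)\<close>. On
  the right, \<open>kt\<close> supplies \<open>a + 1/2\<close> divided by the new length, and the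
  growth of \<open>sqrt n * n ^ n\<close> pays for \<open>exp 1\<close> and for the new
  length.\<close>

lemma kt_lower_step:
  assumes "a + b \<ge> 1"
    and "real a ^ a * real b ^ b \<le> 2 * sqrt (real (a + b)) * real (a + b) ^ (a + b) * kt a b"
  shows "real (Suc a) ^ Suc a * real b ^ b
    \<le> 2 * sqrt (real (Suc a + b)) * real (Suc a + b) ^ (Suc a + b) * kt (Suc a) b"
proof -
  define n where "n = a + b"
  have "(real a + 1) ^ Suc a * real b ^ b \<le> exp 1 * (real a + 1/2) * real a ^ a * real b ^ b"
    by (intro mult_right_mono Suc_power_Suc_le_exp) simp
  also have "\<dots> = exp 1 * (real a + 1/2) * (real a ^ a * real b ^ b)" by simp
  also have "\<dots> \<le> exp 1 * (real a + 1/2) * (2 * sqrt (real n) * real n ^ n * kt a b)"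
    using assms(2) by (intro mult_left_mono) (auto simp: n_def)
  also have "\<dots> = (exp 1 * sqrt (real n) * real n ^ n) * (2 * (real a + 1/2) * kt a b)" by simp
  also have "\<dots> \<le> (sqrt (real n + 1) * (real n + 1) ^ n) * (2 * (real a + 1/2) * kt a b)"
    using assms(1) kt_pos[of a b]
    by (intro mult_right_mono exp_mult_sqrt_power_le) (auto simp: n_def less_imp_le)
  also have "\<dots> = 2 * sqrt (real (Suc n)) * real (Suc n) ^ Suc n * kt (Suc a) b"
    by (simp add: kt_Suc_left n_def field_simps)
  finally show ?thesis by (simp add: n_def add.commute)
qed

text \<open>The constant 2 comes from words of length one, where both sides agree because
  \<open>kt 1 0 = 1/2\<close>. The empty word is excluded since the right side would vanish. As
  \<open>kt_lower_step\<close> appends ones only, a constant word is built first, read as a word of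
  zeros by symmetry, and then extended by ones.\<close>

lemma kt_lower:
  assumes "a + b \<ge> 1"
  shows "real a ^ a * real b ^ b \<le> 2 * sqrt (real (a + b)) * real (a + b) ^ (a + b) * kt a b"
proof -
  have one: "real b ^ b \<le> 2 * sqrt (real b) * real b ^ b * kt b 0" if "b \<ge> 1" for b
    using that
  proof (induction b rule: dec_induct)
    case base
    then show ?case by (simp add: kt_def)
  next
    case (step m)
    then show ?case using kt_lower_step[of m 0] by simp
  qed
  show ?thesis
  proof (cases "b = 0")
    case True
    then show ?thesis using one[of a] assms by simp
  next
    case False
    show ?thesis
    proof (induction a)
      case 0
      then show ?case using one[of b] False by (simp add: kt_commute)
    next
      case (Suc a)
      then show ?case using kt_lower_step[of a b] False by simp
    qed
  qed
qed

section \<open>Likelihood ratios of empirical means\<close>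

lemma mult_ln_div_ge:
  fixes s q :: real
  assumes "0 \<le> s" "0 < q"
  shows "s - q \<le> s * ln (s / q)"
proof (cases "s = 0")
  case False
  then have s: "s > 0" using assms by simp
  have "ln (q / s) \<le> q / s - 1" using s assms by (intro ln_le_minus_one) auto
  then have "s * ln (q / s) \<le> s * (q / s - 1)" using s by (intro mult_left_mono) auto
  also have "\<dots> = q - s" using s by (simp add: field_simps)
  finally show ?thesis using s assms by (simp add: ln_divide_pos algebra_simps)
qed (use assms in auto)

lemma bernoulli_kl_nonneg:
  fixes s q :: real
  assumes "0 \<le> s" "s \<le> 1" "0 < q" "q < 1"
  shows "0 \<le> s * ln (s / q) + (1 - s) * ln ((1 - s) / (1 - q))"
  using mult_ln_div_ge[of s q] mult_ln_div_ge[of "1 - s" "1 - q"] assms by simp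

text \<open>The likelihood is largest at the empirical frequency \<open>s = k / n\<close>: for
  \<open>q\<close> strictly between 0 and 1, the logarithm of the claim is \<open>n\<close> times
  the nonnegativity of the relative entropy of \<open>s\<close> against \<open>q\<close>. At the
  endpoints the powers are evaluated directly, with \<open>0 ^ 0 = 1\<close>.\<close>

lemma bernoulli_likelihood_le:
  fixes q :: real
  assumes q: "0 \<le> q" "q \<le> 1" and n: "k + m \<ge> 1"
  shows "q ^ k * (1 - q) ^ m \<le> real k ^ k * real m ^ m / real (k + m) ^ (k + m)"
proof -
  consider "q = 0" | "q = 1" | "0 < q" "q < 1" using q by linarith
  then show ?thesis
  proof cases
    case 1
    then show ?thesis by (cases "k = 0") (auto simp: power_0_left)
  next
    case 2
    then show ?thesis by (cases "m = 0") (auto simp: power_0_left)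
  next
    case 3
    define n where "n = k + m"
    define s where "s = real k / real n"
    have n0: "n > 0" using n unfolding n_def by linarith
    have "real n = real k + real m" by (simp add: n_def)
    then have s: "0 \<le> s" "s \<le> 1" "1 - s = real m / real n"
      using n0 by (auto simp: s_def field_simps)
    have e: "exp (real j * ln z) = z ^ j" if "z > 0 \<or> (z = 0 \<and> j = 0)" for j and z :: real
      using that by (auto simp: exp_of_nat_mult)
    have sp: "s > 0 \<or> (s = 0 \<and> k = 0)" "1 - s > 0 \<or> (1 - s = 0 \<and> m = 0)"
      unfolding s(3) using n0 by (auto simp: s_def)
    have "0 \<le> s * ln (s / q) + (1 - s) * ln ((1 - s) / (1 - q))"
      using s 3 by (intro bernoulli_kl_nonneg) auto
    moreover have "s * ln (s / q) = s * ln s - s * ln q"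
      using sp(1) 3 by (auto simp: ln_divide_pos algebra_simps)
    moreover have "(1 - s) * ln ((1 - s) / (1 - q)) = (1 - s) * ln (1 - s) - (1 - s) * ln (1 - q)"
      using sp(2) 3 by (auto simp: ln_divide_pos algebra_simps)
    ultimately have "s * ln q + (1 - s) * ln (1 - q) \<le> s * ln s + (1 - s) * ln (1 - s)"
      by linarith
    then have "real n * (s * ln q + (1 - s) * ln (1 - q)) \<le> real n * (s * ln s + (1 - s) * ln (1 - s))"
      by (intro mult_left_mono) auto
    moreover have "real n * s = real k" "real n * (1 - s) = real m"
      unfolding s(3) using n0 by (auto simp: s_def)
    ultimately have "real k * ln q + real m * ln (1 - q) \<le> real k * ln s + real m * ln (1 - s)"
      by (metis (no_types, lifting) distrib_left mult.assoc)
    then have "exp (real k * ln q + real m * ln (1 - q)) \<le> exp (real k * ln s + real m * ln (1 - s))"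
      by simp
    then have "q ^ k * (1 - q) ^ m \<le> s ^ k * (1 - s) ^ m"
      using e[of q k] e[of "1 - q" m] e[OF sp(1)] e[OF sp(2)] 3 by (simp add: exp_add)
    also have "\<dots> = real k ^ k * real m ^ m / real n ^ n"
      unfolding s(3) by (simp add: s_def power_divide n_def power_add)
    finally show ?thesis by (simp add: n_def)
  qed
qed

lemma exp_ln_combination_le:
  fixes x \<alpha> \<beta> :: real
  assumes "0 \<le> x" "x \<le> 1" "\<alpha> > 0 \<or> (\<alpha> = 0 \<and> x = 0)" "\<beta> > 0 \<or> (\<beta> = 0 \<and> x = 1)"
  shows "exp (x * ln \<alpha> + (1 - x) * ln \<beta>) \<le> x * \<alpha> + (1 - x) * \<beta>"
proof -
  have "exp ((1 - x) *\<^sub>R ln \<beta> + x *\<^sub>R ln \<alpha>) \<le> (1 - x) * exp (ln \<beta>) + x * exp (ln \<alpha>)"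
    using assms by (intro convex_onD[OF exp_convex]) auto
  moreover have "x * exp (ln \<alpha>) = x * \<alpha>" "(1 - x) * exp (ln \<beta>) = (1 - x) * \<beta>"
    using assms by auto
  ultimately show ?thesis by (simp add: add.commute)
qed

text \<open>The likelihood ratio of the empirical mean against \<open>p\<close> is dominated by a mixture of
  functions each of which has expectation one when the coordinates are independent with mean \<open>p\<close>;
  the mixing weights are the Krichevsky--Trofimov probabilities.\<close>

lemma exp_bernoulli_kl_le_mixture:
  fixes x :: "nat \<Rightarrow> real" and p :: real
  assumes n: "n \<ge> 1" and x: "\<And>i. i < n \<Longrightarrow> 0 \<le> x i \<and> x i \<le> 1" and p: "0 < p" "p < 1"
  defines "s \<equiv> (\<Sum>i<n. x i) / real n"
  shows "exp (real n * (s * ln (s / p) + (1 - s) * ln ((1 - s) / (1 - p))))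
    \<le> 2 * sqrt (real n) * (\<Sum>S\<in>Pow {..<n}. kt (card S) (card ({..<n} - S)) *
        (\<Prod>i<n. if i \<in> S then x i / p else (1 - x i) / (1 - p)))"
proof -
  define \<alpha> where "\<alpha> = s / p"
  define \<beta> where "\<beta> = (1 - s) / (1 - p)"
  have ns: "real n * s = (\<Sum>i<n. x i)" "real n * (1 - s) = (\<Sum>i<n. 1 - x i)"
    using n by (auto simp: s_def sum_subtractf right_diff_distrib)
  have s0: "0 \<le> s" unfolding s_def using x by (intro divide_nonneg_nonneg sum_nonneg) auto
  have "0 \<le> real n * (1 - s)" unfolding ns using x by (intro sum_nonneg) auto
  then have s1: "s \<le> 1" using n by (simp add: zero_le_mult_iff)
  have a0: "\<alpha> \<ge> 0" "\<beta> \<ge> 0" using s0 s1 p by (auto simp: \<alpha>_def \<beta>_def)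
  \<comment> \<open>When \<open>s\<close> is 0 or 1, a sum of nonnegative terms vanishes and every
    coordinate equals \<open>s\<close>; this is the degenerate case that
    \<open>exp_ln_combination_le\<close> asks for.\<close>
  have za: "x i = 0" if "\<alpha> = 0" "i < n" for i
  proof -
    have "(\<Sum>i<n. x i) = 0" using that p ns(1) by (simp add: \<alpha>_def)
    then show ?thesis using x that by (subst (asm) sum_nonneg_eq_0_iff) auto
  qed
  have zb: "x i = 1" if "\<beta> = 0" "i < n" for i
  proof -
    have "(\<Sum>i<n. 1 - x i) = 0" using that p ns(2) by (simp add: \<beta>_def)
    then show ?thesis using x that by (subst (asm) sum_nonneg_eq_0_iff) auto
  qed
  have "real n * (s * ln \<alpha> + (1 - s) * ln \<beta>) = (real n * s) * ln \<alpha> + (real n * (1 - s)) * ln \<beta>"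
    by (simp add: algebra_simps)
  also have "\<dots> = (\<Sum>i<n. x i * ln \<alpha> + (1 - x i) * ln \<beta>)"
    unfolding ns by (simp add: sum.distrib sum_distrib_right)
  finally have "exp (real n * (s * ln \<alpha> + (1 - s) * ln \<beta>)) = (\<Prod>i<n. exp (x i * ln \<alpha> + (1 - x i) * ln \<beta>))"
    by (simp add: exp_sum)
  \<comment> \<open>By AM-GM a coordinate in \<open>[0, 1]\<close> is in effect replaced by a random
    bit of mean \<open>x i\<close>; expanding the product then sums over bit words, with
    \<open>S\<close> the positions of the ones.\<close>
  also have "\<dots> \<le> (\<Prod>i<n. x i * \<alpha> + (1 - x i) * \<beta>)"
  proof (intro prod_mono conjI)
    fix i assume i: "i \<in> {..<n}"
    then show "exp (x i * ln \<alpha> + (1 - x i) * ln \<beta>) \<le> x i * \<alpha> + (1 - x i) * \<beta>"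
      using x[of i] a0 za[of i] zb[of i] by (intro exp_ln_combination_le) (auto simp: order_le_less)
  qed auto
  also have "\<dots> = (\<Sum>S\<in>Pow {..<n}. (\<Prod>i\<in>S. x i * \<alpha>) * (\<Prod>i\<in>{..<n} - S. (1 - x i) * \<beta>))"
    by (rule prod_add) simp
  also have "\<dots> \<le> (\<Sum>S\<in>Pow {..<n}. 2 * sqrt (real n) * (kt (card S) (card ({..<n} - S)) *
        (\<Prod>i<n. if i \<in> S then x i / p else (1 - x i) / (1 - p))))"
  proof (intro sum_mono)
    fix S assume S: "S \<in> Pow {..<n}"
    define k where "k = card S"
    define m where "m = card ({..<n} - S)"
    have fS: "finite S" using S by (auto intro: finite_subset)
    have km: "k + m = n"
      using S fS card_mono[of "{..<n}" S] by (auto simp: k_def m_def card_Diff_subset)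
    define X where "X = (\<Prod>i\<in>S. x i / p) * (\<Prod>i\<in>{..<n} - S. (1 - x i) / (1 - p))"
    have X0: "X \<ge> 0" unfolding X_def using x p S
      by (intro mult_nonneg_nonneg prod_nonneg) auto
    have Xif: "X = (\<Prod>i<n. if i \<in> S then x i / p else (1 - x i) / (1 - p))"
    proof -
      have "{..<n} \<inter> {i. i \<in> S} = S" "{..<n} \<inter> - {i. i \<in> S} = {..<n} - S" using S by auto
      then show ?thesis unfolding X_def by (subst prod.If_cases) auto
    qed
    \<comment> \<open>Pulling \<open>s\<close> out of \<open>\<alpha>\<close> and
      \<open>1 - s\<close> out of \<open>\<beta>\<close> isolates the likelihood of a word with
      \<open>k\<close> ones at the data-dependent parameter \<open>s\<close>; this is the only
      factor that has to be replaced by a constant.\<close>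
    have "(\<Prod>i\<in>S. x i * \<alpha>) * (\<Prod>i\<in>{..<n} - S. (1 - x i) * \<beta>) = X * (s ^ k * (1 - s) ^ m)"
    proof -
      have "(\<Prod>i\<in>S. x i * \<alpha>) = (\<Prod>i\<in>S. x i / p) * s ^ k"
        by (simp add: \<alpha>_def k_def prod.distrib prod_dividef power_divide)
      moreover have "(\<Prod>i\<in>{..<n} - S. (1 - x i) * \<beta>) = (\<Prod>i\<in>{..<n} - S. (1 - x i) / (1 - p)) * (1 - s) ^ m"
        by (simp add: \<beta>_def m_def prod.distrib prod_dividef power_divide)
      ultimately show ?thesis by (simp add: X_def)
    qed
    moreover have "s ^ k * (1 - s) ^ m \<le> real k ^ k * real m ^ m / real (k + m) ^ (k + m)"
      using s0 s1 n km by (intro bernoulli_likelihood_le) auto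
    moreover have "\<dots> \<le> 2 * sqrt (real n) * kt k m"
      using kt_lower[of k m] n km by (simp add: divide_le_eq mult_ac)
    ultimately have "(\<Prod>i\<in>S. x i * \<alpha>) * (\<Prod>i\<in>{..<n} - S. (1 - x i) * \<beta>)
        \<le> X * (2 * sqrt (real n) * kt k m)"
      using X0 by (simp only:) (intro mult_left_mono, auto)
    then show "(\<Prod>i\<in>S. x i * \<alpha>) * (\<Prod>i\<in>{..<n} - S. (1 - x i) * \<beta>)
        \<le> 2 * sqrt (real n) * (kt (card S) (card ({..<n} - S)) *
        (\<Prod>i<n. if i \<in> S then x i / p else (1 - x i) / (1 - p)))"
      unfolding Xif[symmetric] k_def[symmetric] m_def[symmetric]
      by (simp only: mult_ac)
  qed
  finally show ?thesis by (simp add: \<alpha>_def \<beta>_def sum_distrib_left)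
qed

section \<open>The extended-valued divergence and its exponential moment\<close>

lemma measurable_kl_term [measurable]:
  assumes [measurable]: "f \<in> borel_measurable M" "g \<in> borel_measurable M"
  shows "(\<lambda>x. kl_term (f x) (g x)) \<in> borel_measurable M"
  unfolding kl_term_def by measurable

lemma measurable_kl [measurable]:
  assumes [measurable]: "f \<in> borel_measurable M" "g \<in> borel_measurable M"
  shows "(\<lambda>x. kl (f x) (g x)) \<in> borel_measurable M"
  unfolding kl_def by measurable

lemma kl_interior:
  assumes "0 < t" "t < 1"
  shows "kl s t = ennreal (s * ln (s / t) + (1 - s) * ln ((1 - s) / (1 - t)))"
  using assms by (auto simp: kl_def kl_term_def)

lemma kl_0_0: "kl 0 0 = 0" and kl_1_1: "kl 1 1 = 0"
  by (auto simp: kl_def kl_term_def zero_ereal_def[symmetric])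

text \<open>\<open>enn2real\<close> sends \<open>\<top>\<close> to 0, so an infinite divergence
  needs a branch of its own.\<close>

definition exp_kl :: "real \<Rightarrow> real \<Rightarrow> real \<Rightarrow> ennreal" where
  "exp_kl c s t = (if kl s t = \<top> then \<top> else ennreal (exp (c * enn2real (kl s t))))"

lemma measurable_exp_kl [measurable]:
  assumes [measurable]: "f \<in> borel_measurable M" "g \<in> borel_measurable M"
  shows "(\<lambda>x. exp_kl c (f x) (g x)) \<in> borel_measurable M"
  unfolding exp_kl_def by measurable

text \<open>By independence every product in the mixture has expectation one, so what is left is
  \<open>2 * sqrt n\<close> times the total weight \<open>kt 0 0 = 1\<close>.\<close>

lemma nn_integral_exp_kl_le:
  assumes "prob_space \<mu>" and [measurable]: "g \<in> borel_measurable \<mu>"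
    and g: "\<And>x. x \<in> space \<mu> \<Longrightarrow> 0 \<le> g x \<and> g x \<le> 1" and n: "n \<ge> 1"
  shows "(\<integral>\<^sup>+xs. exp_kl (real n) ((\<Sum>i<n. g (xs i)) / real n) (\<integral>x. g x \<partial>\<mu>) \<partial>sample_space n \<mu>)
    \<le> ennreal (2 * sqrt (real n))"
proof -
  interpret prob_space \<mu> by fact
  interpret P: product_prob_space "\<lambda>_::nat. \<mu>" "{..<n}" by unfold_locales
  define p where "p = (\<integral>x. g x \<partial>\<mu>)"
  have ig [intro, simp]: "integrable \<mu> g"
    using g by (intro integrable_const_bound[where B=1]) auto
  have gAE: "AE x in \<mu>. 0 \<le> g x" "AE x in \<mu>. 0 \<le> 1 - g x" using g by auto
  have p0: "0 \<le> p" unfolding p_def using g by (intro integral_nonneg_AE) auto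
  have p1': "1 - p = (\<integral>x. 1 - g x \<partial>\<mu>)" unfolding p_def by (simp add: prob_space)
  have p1: "p \<le> 1"
    using integral_nonneg_AE[OF gAE(2)] p1' by simp
  have sp: "xs i \<in> space \<mu>" if "xs \<in> space (sample_space n \<mu>)" "i < n" for xs i
    using that by (auto simp: space_PiM PiE_iff)
  have one: "(1::ennreal) \<le> ennreal (2 * sqrt (real n))"
  proof -
    have "(1::real) \<le> sqrt (real n)" using n by simp
    then have "1 \<le> 2 * sqrt (real n)" by linarith
    then show ?thesis by simp
  qed
  \<comment> \<open>The mixture bound divides by \<open>p\<close> and \<open>1 - p\<close>. A mean
    of 0 or 1 forces \<open>g\<close> to be almost surely that constant; the empirical mean then
    equals the true one and the integrand is 1.\<close>
  have degenerate: ?thesis if c: "AE x in \<mu>. g x = c" and klc: "kl c p = 0" for c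
  proof -
    have "AE xs in sample_space n \<mu>. \<forall>i\<in>{..<n}. g (xs i) = c"
      using c by (intro AE_finite_allI) (auto intro!: P.AE_component)
    then have "AE xs in sample_space n \<mu>. exp_kl (real n) ((\<Sum>i<n. g (xs i)) / real n) p = 1"
    proof eventually_elim
      case (elim xs)
      then have "(\<Sum>i<n. g (xs i)) / real n = c" using n by simp
      then show ?case using klc by (simp add: exp_kl_def)
    qed
    then have "(\<integral>\<^sup>+xs. exp_kl (real n) ((\<Sum>i<n. g (xs i)) / real n) p \<partial>sample_space n \<mu>)
        = (\<integral>\<^sup>+xs. 1 \<partial>sample_space n \<mu>)"
      by (rule nn_integral_cong_AE)
    then show ?thesis using one by (simp add: p_def P.emeasure_space_1)
  qed
  consider "p = 0" | "p = 1" | "0 < p" "p < 1" using p0 p1 by linarith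
  then show ?thesis
  proof cases
    case 1
    then have "AE x in \<mu>. g x = 0"
      using integral_nonneg_eq_0_iff_AE[OF ig gAE(1)] by (simp add: p_def)
    then show ?thesis using 1 by (intro degenerate[of 0]) (auto simp: kl_0_0)
  next
    case 2
    then have "AE x in \<mu>. 1 - g x = 0"
      using integral_nonneg_eq_0_iff_AE[OF _ gAE(2)] p1' by simp
    then have "AE x in \<mu>. g x = 1" by simp
    then show ?thesis using 2 by (intro degenerate[of 1]) (auto simp: kl_1_1)
  next
    case 3
    define F where "F = (\<lambda>(S::nat set) i y. if i \<in> S then g y / p else (1 - g y) / (1 - p))"
    define B where "B = (\<lambda>xs. 2 * sqrt (real n) * (\<Sum>S\<in>Pow {..<n}. kt (card S) (card ({..<n} - S)) *
        (\<Prod>i<n. F S i (xs i))))"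
    have iF: "integrable \<mu> (F S i)" for S i
      unfolding F_def by (cases "i \<in> S") auto
    have "integral\<^sup>L \<mu> (F S i) = 1" for S i
      using 3 p1' by (cases "i \<in> S") (auto simp: F_def p_def)
    then have IF: "(\<integral>xs. (\<Prod>i<n. F S i (xs i)) \<partial>sample_space n \<mu>) = 1" for S
      using iF by (subst P.product_integral_prod) auto
    have iP: "integrable (sample_space n \<mu>) (\<lambda>xs. \<Prod>i<n. F S i (xs i))" for S
      using iF by (intro P.product_integrable_prod) auto
    have "(\<integral>xs. B xs \<partial>sample_space n \<mu>)
        = 2 * sqrt (real n) * (\<Sum>S\<in>Pow {..<n}. kt (card S) (card ({..<n} - S)))"
      unfolding B_def using iP by (simp add: IF)
    also have "\<dots> = 2 * sqrt (real n)"
      using sum_kt_Pow[of "{..<n}" 0 0] by (simp add: kt_def)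
    finally have IB: "(\<integral>xs. B xs \<partial>sample_space n \<mu>) = 2 * sqrt (real n)" .
    have iB: "integrable (sample_space n \<mu>) B"
      unfolding B_def using iP by auto
    have le: "exp_kl (real n) ((\<Sum>i<n. g (xs i)) / real n) p \<le> ennreal (B xs) \<and> 0 \<le> B xs"
      if xs: "xs \<in> space (sample_space n \<mu>)" for xs
    proof -
      define s where "s = (\<Sum>i<n. g (xs i)) / real n"
      have gx: "0 \<le> g (xs i) \<and> g (xs i) \<le> 1" if "i < n" for i
        using g sp[OF xs that] by auto
      have s0: "0 \<le> s" unfolding s_def using gx by (intro divide_nonneg_nonneg sum_nonneg) auto
      have "(\<Sum>i<n. g (xs i)) \<le> (\<Sum>i<n. 1)" using gx by (intro sum_mono) auto
      then have s1: "s \<le> 1" using n by (simp add: s_def divide_le_eq)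
      have "exp (real n * (s * ln (s / p) + (1 - s) * ln ((1 - s) / (1 - p)))) \<le> B xs"
        unfolding s_def B_def F_def using gx n 3 by (intro exp_bernoulli_kl_le_mixture) auto
      moreover have "exp_kl (real n) s p
          = ennreal (exp (real n * (s * ln (s / p) + (1 - s) * ln ((1 - s) / (1 - p)))))"
        using bernoulli_kl_nonneg[OF s0 s1 3] by (simp add: exp_kl_def kl_interior 3)
      ultimately show ?thesis
        by (auto simp: s_def intro!: ennreal_leI elim: order_trans[rotated])
    qed
    have "(\<integral>\<^sup>+xs. exp_kl (real n) ((\<Sum>i<n. g (xs i)) / real n) p \<partial>sample_space n \<mu>)
        \<le> (\<integral>\<^sup>+xs. ennreal (B xs) \<partial>sample_space n \<mu>)"
      using le by (intro nn_integral_mono) auto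
    also have "\<dots> = ennreal (2 * sqrt (real n))"
      using iB le by (subst nn_integral_eq_integral) (auto simp: IB)
    finally show ?thesis by (simp add: p_def)
  qed
qed

section \<open>Entropy and exponential moments of self-bounding functions\<close>

definition ent :: "'a measure \<Rightarrow> ('a \<Rightarrow> real) \<Rightarrow> real" where
  "ent M Y = (\<integral>x. Y x * ln (Y x) \<partial>M) - (\<integral>x. Y x \<partial>M) * ln (\<integral>x. Y x \<partial>M)"

lemma (in prob_space) integrable_between:
  fixes Y :: "'a \<Rightarrow> real"
  assumes "Y \<in> borel_measurable M" "\<And>x. x \<in> space M \<Longrightarrow> a \<le> Y x \<and> Y x \<le> b"
  shows "integrable M Y"
proof (rule integrable_const_bound[where B = "\<bar>a\<bar> + \<bar>b\<bar>"])
  have "norm (Y x) \<le> \<bar>a\<bar> + \<bar>b\<bar>" if "x \<in> space M" for x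
    using assms(2)[OF that] by (auto simp: abs_if)
  then show "AE x in M. norm (Y x) \<le> \<bar>a\<bar> + \<bar>b\<bar>" by (intro AE_I2)
qed fact

lemma (in prob_space) integral_between:
  fixes Y :: "'a \<Rightarrow> real"
  assumes "Y \<in> borel_measurable M" "\<And>x. x \<in> space M \<Longrightarrow> a \<le> Y x \<and> Y x \<le> b"
  shows "a \<le> (\<integral>x. Y x \<partial>M) \<and> (\<integral>x. Y x \<partial>M) \<le> b"
proof -
  have "(\<integral>x. a \<partial>M) \<le> (\<integral>x. Y x \<partial>M)" "(\<integral>x. Y x \<partial>M) \<le> (\<integral>x. b \<partial>M)"
    using integrable_between[OF assms] assms(2) by (intro integral_mono; simp)+
  then show ?thesis by (simp add: prob_space)
qed

lemma abs_mult_ln_le: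
  fixes a b y z :: real
  assumes "0 < a" "a \<le> y" "y \<le> b" "a \<le> z" "z \<le> b"
  shows "\<bar>y * ln z\<bar> \<le> b * (\<bar>ln a\<bar> + \<bar>ln b\<bar>)"
proof -
  have "ln a \<le> ln z" "ln z \<le> ln b" using assms by auto
  then have "\<bar>ln z\<bar> \<le> \<bar>ln a\<bar> + \<bar>ln b\<bar>" by linarith
  then show ?thesis using assms by (auto simp: abs_mult intro!: mult_mono)
qed

lemma (in prob_space) integrable_mult_ln:
  fixes Y Z :: "'a \<Rightarrow> real"
  assumes [measurable]: "Y \<in> borel_measurable M" "Z \<in> borel_measurable M"
    and "0 < a" "\<And>x. x \<in> space M \<Longrightarrow> a \<le> Y x \<and> Y x \<le> b"
    "\<And>x. x \<in> space M \<Longrightarrow> a \<le> Z x \<and> Z x \<le> b"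
  shows "integrable M (\<lambda>x. Y x * ln (Z x))"
proof (rule integrable_const_bound[where B = "b * (\<bar>ln a\<bar> + \<bar>ln b\<bar>)"])
  show "AE x in M. norm (Y x * ln (Z x)) \<le> b * (\<bar>ln a\<bar> + \<bar>ln b\<bar>)"
    unfolding real_norm_def using assms(3-) by (intro AE_I2 abs_mult_ln_le) auto
qed measurable

lemma (in prob_space) abs_ent_le:
  assumes [measurable]: "Y \<in> borel_measurable M"
    and "0 < a" and Y: "\<And>x. x \<in> space M \<Longrightarrow> a \<le> Y x \<and> Y x \<le> b"
  shows "\<bar>ent M Y\<bar> \<le> 2 * (b * (\<bar>ln a\<bar> + \<bar>ln b\<bar>))"
proof -
  define K where "K = b * (\<bar>ln a\<bar> + \<bar>ln b\<bar>)"
  have "\<bar>Y x * ln (Y x)\<bar> \<le> K" if "x \<in> space M" for x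
    unfolding K_def using assms(2) Y[OF that] by (intro abs_mult_ln_le) auto
  then have "- K \<le> (\<integral>x. Y x * ln (Y x) \<partial>M) \<and> (\<integral>x. Y x * ln (Y x) \<partial>M) \<le> K"
    by (intro integral_between) (auto simp: abs_le_iff minus_le_iff)
  moreover have "\<bar>(\<integral>x. Y x \<partial>M) * ln (\<integral>x. Y x \<partial>M)\<bar> \<le> K"
    unfolding K_def using assms(2) integral_between[of Y a b] Y by (intro abs_mult_ln_le) auto
  ultimately show ?thesis unfolding ent_def K_def[symmetric] by linarith
qed

text \<open>Apply \<open>ln u \<le> u - 1\<close> to the quotient \<open>u\<close> of the normalized
  functions \<open>Z / r\<close> and \<open>Y / m\<close>, and weight by \<open>Y\<close>; the right
  side then integrates to zero. Equality holds for \<open>Z = Y\<close>, so entropy is a supremum of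
  functionals linear in \<open>Y\<close>.\<close>

lemma (in prob_space) ent_variational:
  assumes [measurable]: "Y \<in> borel_measurable M" "Z \<in> borel_measurable M"
    and a: "0 < a" and Y: "\<And>x. x \<in> space M \<Longrightarrow> a \<le> Y x \<and> Y x \<le> b"
    and Z: "\<And>x. x \<in> space M \<Longrightarrow> a \<le> Z x \<and> Z x \<le> b"
  shows "(\<integral>x. Y x * (ln (Z x) - ln (\<integral>x. Z x \<partial>M)) \<partial>M) \<le> ent M Y"
proof -
  define m where "m = (\<integral>x. Y x \<partial>M)"
  define r where "r = (\<integral>x. Z x \<partial>M)"
  have m: "m > 0" and r: "r > 0"
    using integral_between[of Y a b] integral_between[of Z a b] Y Z a by (auto simp: m_def r_def)
  note int [simp] = integrable_between[of Y a b, OF _ Y] integrable_between[of Z a b, OF _ Z]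
    integrable_mult_ln[of Y Z a b, OF _ _ a Y Z] integrable_mult_ln[of Y Y a b, OF _ _ a Y Y]
  have "(\<integral>x. Y x * (ln (Z x) - ln r) \<partial>M) - ent M Y
      = (\<integral>x. Y x * ln (Z x) - Y x * ln r - Y x * ln (Y x) + Y x * ln m \<partial>M)"
    by (simp add: ent_def m_def[symmetric] right_diff_distrib)
  also have "\<dots> \<le> (\<integral>x. Z x * (m / r) - Y x \<partial>M)"
  proof (rule integral_mono)
    fix x assume x: "x \<in> space M"
    have p: "Y x > 0" "Z x > 0" using Y[OF x] Z[OF x] a by auto
    have "Y x * ln (Z x * m / (r * Y x)) \<le> Y x * (Z x * m / (r * Y x) - 1)"
      using p m r by (intro mult_left_mono ln_le_minus_one) auto
    also have "\<dots> = Z x * (m / r) - Y x" using p r by (simp add: field_simps)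
    also have "ln (Z x * m / (r * Y x)) = ln (Z x) + ln m - (ln r + ln (Y x))"
      using p m r by (simp add: ln_divide_pos ln_mult_pos)
    finally show "Y x * ln (Z x) - Y x * ln r - Y x * ln (Y x) + Y x * ln m \<le> Z x * (m / r) - Y x"
      by (simp add: algebra_simps)
  qed auto
  also have "\<dots> = 0" using r by (simp add: m_def[symmetric] r_def[symmetric])
  finally show ?thesis by (simp add: r_def)
qed

lemma measurable_ent [measurable (raw)]:
  assumes "sigma_finite_measure N" and [measurable]: "case_prod Y \<in> borel_measurable (M \<Otimes>\<^sub>M N)"
  shows "(\<lambda>x. ent N (Y x)) \<in> borel_measurable M"
proof -
  interpret sigma_finite_measure N by fact
  show ?thesis unfolding ent_def by measurable
qed

text \<open>Convexity of entropy, as for any supremum of linear functionals. The functional that is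
  optimal for the averaged function \<open>Z\<close> is linear, so Fubini moves the average over
  \<open>M\<close> outside; for each single \<open>x\<close> the functional is at most
  \<open>ent N (Y x)\<close>.\<close>

lemma ent_integral_le:
  assumes "prob_space M" "prob_space N"
    and [measurable]: "case_prod Y \<in> borel_measurable (M \<Otimes>\<^sub>M N)"
    and a: "0 < a"
    and Y: "\<And>x y. x \<in> space M \<Longrightarrow> y \<in> space N \<Longrightarrow> a \<le> Y x y \<and> Y x y \<le> b"
  shows "ent N (\<lambda>y. \<integral>x. Y x y \<partial>M) \<le> (\<integral>x. ent N (Y x) \<partial>M)"
proof -
  interpret M: prob_space M by fact
  interpret N: prob_space N by fact
  interpret MN: pair_prob_space M N ..
  define Z where "Z = (\<lambda>y. \<integral>x. Y x y \<partial>M)"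
  define m where "m = (\<integral>y. Z y \<partial>N)"
  have [measurable]: "Z \<in> borel_measurable N" unfolding Z_def by measurable
  have Z: "a \<le> Z y \<and> Z y \<le> b" if "y \<in> space N" for y
    unfolding Z_def using Y that by (intro M.integral_between) auto
  have m: "a \<le> m \<and> m \<le> b" unfolding m_def using Z by (intro N.integral_between) auto
  define K where "K = b * (\<bar>ln a\<bar> + \<bar>ln b\<bar>)"
  have bd: "norm (Y x y * (ln (Z y) - ln m)) \<le> 2 * K" if "x \<in> space M" "y \<in> space N" for x y
  proof -
    have "\<bar>Y x y * ln (Z y)\<bar> \<le> K" "\<bar>Y x y * ln m\<bar> \<le> K"
      unfolding K_def using Y[OF that] Z[OF that(2)] m a by (auto intro!: abs_mult_ln_le)
    then show ?thesis by (simp add: right_diff_distrib)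
  qed
  have intZ: "integrable N Z" using Z by (intro N.integrable_between) auto
  have intZl: "integrable N (\<lambda>y. Z y * ln (Z y))" using Z a by (intro N.integrable_mult_ln[where a=a and b=b]) auto
  have "ent N Z = (\<integral>y. Z y * (ln (Z y) - ln m) \<partial>N)"
    using intZ intZl by (simp add: ent_def right_diff_distrib m_def[symmetric])
  also have "\<dots> = (\<integral>y. (\<integral>x. Y x y * (ln (Z y) - ln m) \<partial>M) \<partial>N)"
    unfolding Z_def by simp
  also have "\<dots> = (\<integral>x. (\<integral>y. Y x y * (ln (Z y) - ln m) \<partial>N) \<partial>M)"
  proof (rule MN.Fubini_integral)
    show "integrable (M \<Otimes>\<^sub>M N) (\<lambda>(x, y). Y x y * (ln (Z y) - ln m))"
      using bd by (intro MN.integrable_const_bound[where B="2 * K"] AE_I2) (auto simp: space_pair_measure)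
  qed
  also have "\<dots> \<le> (\<integral>x. ent N (Y x) \<partial>M)"
  proof (rule integral_mono)
    have "norm (\<integral>y. Y x y * (ln (Z y) - ln m) \<partial>N) \<le> 2 * K" if "x \<in> space M" for x
    proof -
      have [measurable]: "Y x \<in> borel_measurable N"
        using that by measurable
      have "- (2 * K) \<le> (\<integral>y. Y x y * (ln (Z y) - ln m) \<partial>N) \<and> (\<integral>y. Y x y * (ln (Z y) - ln m) \<partial>N) \<le> 2 * K"
        using bd[OF that] by (intro N.integral_between) (auto simp: abs_le_iff minus_le_iff)
      then show ?thesis by (auto simp: abs_le_iff minus_le_iff)
    qed
    then show "integrable M (\<lambda>x. \<integral>y. Y x y * (ln (Z y) - ln m) \<partial>N)"
      by (intro M.integrable_const_bound[where B="2 * K"] AE_I2) auto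
    show "integrable M (\<lambda>x. ent N (Y x))"
    proof (rule M.integrable_const_bound[where B="2 * K"])
      show "AE x in M. norm (ent N (Y x)) \<le> 2 * K"
        unfolding real_norm_def K_def using Y a by (intro AE_I2 N.abs_ent_le) auto
    qed (use N.sigma_finite_measure_axioms in measurable)
    fix x assume x: "x \<in> space M"
    then have [measurable]: "Y x \<in> borel_measurable N" by measurable
    show "(\<integral>y. Y x y * (ln (Z y) - ln m) \<partial>N) \<le> ent N (Y x)"
      unfolding m_def using Z Y[OF x] a by (intro N.ent_variational[where a=a and b=b]) auto
  qed
  finally show ?thesis by (simp add: Z_def)
qed

section \<open>Tensorization over the coordinates of a product space\<close>

lemma measurable_fun_upd_coordinate:
  assumes "j \<in> I"
  shows "(\<lambda>(x, z). x(j := z)) \<in> measurable (PiM I M \<Otimes>\<^sub>M M j) (PiM I M)"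
  using measurable_add_dim[of j I M] assms by (simp add: insert_absorb)

lemma fun_upd_space_PiM:
  "x \<in> space (PiM I M) \<Longrightarrow> z \<in> space (M j) \<Longrightarrow> x(j := z) \<in> space (PiM (insert j I) M)"
  by (auto simp: space_PiM PiE_iff extensional_def)

lemma fun_upd_space_PiM_same:
  "j \<in> I \<Longrightarrow> x \<in> space (PiM I M) \<Longrightarrow> z \<in> space (M j) \<Longrightarrow> x(j := z) \<in> space (PiM I M)"
  using fun_upd_space_PiM[of x I M z j] by (simp add: insert_absorb)

lemma integrable_ent_coordinate:
  fixes M :: "'i \<Rightarrow> 'a measure"
  assumes M: "\<And>i. prob_space (M i)" and j: "j \<in> I"
    and Ym: "Y \<in> borel_measurable (PiM I M)" and a: "0 < a"
    and Y: "\<And>x. x \<in> space (PiM I M) \<Longrightarrow> a \<le> Y x \<and> Y x \<le> b"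
  shows "integrable (PiM I M) (\<lambda>x. ent (M j) (\<lambda>z. Y (x(j := z))))"
proof -
  interpret P: prob_space "PiM I M" by (intro prob_space_PiM M)
  interpret Mj: prob_space "M j" by (rule M)
  have upd: "(\<lambda>(x, z). Y (x(j := z))) \<in> borel_measurable (PiM I M \<Otimes>\<^sub>M M j)"
    using measurable_compose[OF measurable_fun_upd_coordinate[OF j] Ym]
    by (simp add: split_beta' fun_upd_def)
  show ?thesis
  proof (rule P.integrable_const_bound[where B = "2 * (b * (\<bar>ln a\<bar> + \<bar>ln b\<bar>))"])
    show "AE x in PiM I M. norm (ent (M j) (\<lambda>z. Y (x(j := z)))) \<le> 2 * (b * (\<bar>ln a\<bar> + \<bar>ln b\<bar>))"
      unfolding real_norm_def
    proof (intro AE_I2 Mj.abs_ent_le a)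
      fix x assume x: "x \<in> space (PiM I M)"
      show "(\<lambda>z. Y (x(j := z))) \<in> borel_measurable (M j)"
        using x measurable_compose[OF measurable_Pair1' upd] by simp
      show "a \<le> Y (x(j := z)) \<and> Y (x(j := z)) \<le> b" if "z \<in> space (M j)" for z
        using j x that by (intro Y fun_upd_space_PiM_same)
    qed
    show "(\<lambda>x. ent (M j) (\<lambda>z. Y (x(j := z)))) \<in> borel_measurable (PiM I M)"
      by (intro measurable_ent upd prob_space_imp_sigma_finite[OF M])
  qed
qed

text \<open>By the chain rule, the entropy over one more coordinate is the mean entropy in that
  coordinate plus the entropy of the partial average \<open>Z\<close>. The induction hypothesis
  speaks about \<open>Z\<close>, and convexity of entropy leads back from \<open>Z\<close> to
  \<open>Y\<close>.\<close>

lemma ent_tensorization: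
  fixes M :: "'i \<Rightarrow> 'a measure"
  assumes M: "\<And>i. prob_space (M i)" and "finite I"
    and "Y \<in> borel_measurable (PiM I M)" and a: "0 < a"
    and "\<And>x. x \<in> space (PiM I M) \<Longrightarrow> a \<le> Y x \<and> Y x \<le> b"
  shows "ent (PiM I M) Y \<le> (\<Sum>i\<in>I. \<integral>x. ent (M i) (\<lambda>y. Y (x(i := y))) \<partial>PiM I M)"
  using assms(2,3,5)
proof (induction I arbitrary: Y)
  case empty
  then show ?case by (simp add: ent_def PiM_empty lebesgue_integral_count_space_finite)
next
  case (insert i I)
  note [measurable] = insert.prems(1)
  interpret product_sigma_finite M
    using M by (simp add: product_sigma_finite_def prob_space_imp_sigma_finite)
  interpret PI: prob_space "PiM I M" by (intro prob_space_PiM M)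
  interpret PJ: prob_space "PiM (insert i I) M" by (intro prob_space_PiM M)
  interpret Mi: prob_space "M i" by (rule M)
  define K where "K = 2 * (b * (\<bar>ln a\<bar> + \<bar>ln b\<bar>))"
  define Z where "Z = (\<lambda>x. \<integral>y. Y (x(i := y)) \<partial>M i)"
  have m1 [measurable]: "(\<lambda>(x, y). Y (x(i := y))) \<in> borel_measurable (PiM I M \<Otimes>\<^sub>M M i)"
    using measurable_compose[OF measurable_add_dim insert.prems(1)] by (simp add: case_prod_beta)
  have [measurable]: "Z \<in> borel_measurable (PiM I M)" unfolding Z_def by measurable
  have Yb: "a \<le> Y (x(i := y)) \<and> Y (x(i := y)) \<le> b" if "x \<in> space (PiM I M)" "y \<in> space (M i)" for x y
    using that by (intro insert.prems fun_upd_space_PiM)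
  have Y1 [measurable]: "(\<lambda>y. Y (x(i := y))) \<in> borel_measurable (M i)" if "x \<in> space (PiM I M)" for x
    using that measurable_compose[OF measurable_Pair1' m1] by simp
  have Zb: "a \<le> Z x \<and> Z x \<le> b" if "x \<in> space (PiM I M)" for x
    unfolding Z_def using Yb that by (intro Mi.integral_between Y1) auto
  have int_ent: "integrable (PiM I M) (\<lambda>x. ent (M i) (\<lambda>y. Y (x(i := y))))"
  proof (rule PI.integrable_const_bound[where B = K])
    show "AE x in PiM I M. norm (ent (M i) (\<lambda>y. Y (x(i := y)))) \<le> K"
      unfolding real_norm_def K_def using Yb a by (intro AE_I2 Mi.abs_ent_le Y1) auto
  qed (use prob_space_imp_sigma_finite[OF M] m1 in \<open>auto intro!: measurable_ent\<close>)
  have intZ: "integrable (PiM I M) (\<lambda>x. Z x * ln (Z x))"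
    using Zb a by (intro PI.integrable_mult_ln[where a=a and b=b]) auto
  have ins: "integral\<^sup>L (PiM (insert i I) M) f = (\<integral>x. (\<integral>y. f (x(i := y)) \<partial>M i) \<partial>PiM I M)"
    if "integrable (PiM (insert i I) M) f" for f :: "_ \<Rightarrow> real"
    using that insert.hyps by (intro product_integral_insert) auto

  have intY: "integrable (PiM (insert i I) M) Y"
    using insert.prems by (intro PJ.integrable_between[where a=a and b=b]) auto
  have intYl: "integrable (PiM (insert i I) M) (\<lambda>x. Y x * ln (Y x))"
    using insert.prems a by (intro PJ.integrable_mult_ln[where a=a and b=b]) auto
  have "ent (PiM (insert i I) M) Y
      = (\<integral>x. (\<integral>y. Y (x(i := y)) * ln (Y (x(i := y))) \<partial>M i) \<partial>PiM I M)
        - (\<integral>x. Z x \<partial>PiM I M) * ln (\<integral>x. Z x \<partial>PiM I M)"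
    unfolding ent_def Z_def by (simp add: ins[OF intY] ins[OF intYl])
  also have "(\<integral>x. (\<integral>y. Y (x(i := y)) * ln (Y (x(i := y))) \<partial>M i) \<partial>PiM I M)
      = (\<integral>x. ent (M i) (\<lambda>y. Y (x(i := y))) + Z x * ln (Z x) \<partial>PiM I M)"
    by (simp add: ent_def Z_def)
  also have "\<dots> = (\<integral>x. ent (M i) (\<lambda>y. Y (x(i := y))) \<partial>PiM I M) + (\<integral>x. Z x * ln (Z x) \<partial>PiM I M)"
    using int_ent intZ by simp
  finally have chain: "ent (PiM (insert i I) M) Y
      = (\<integral>x. ent (M i) (\<lambda>y. Y (x(i := y))) \<partial>PiM I M) + ent (PiM I M) Z"
    by (simp add: ent_def)

  have upd [measurable]: "(\<lambda>(w, z). Y (w(j := z))) \<in> borel_measurable (PiM (insert i I) M \<Otimes>\<^sub>M M j)"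
    if "j \<in> insert i I" for j
    using measurable_compose[OF measurable_fun_upd_coordinate[OF that] insert.prems(1)]
    by (simp add: split_beta' fun_upd_def)
  have int_j: "integrable (PiM (insert i I) M) (\<lambda>w. ent (M j) (\<lambda>z. Y (w(j := z))))"
    if "j \<in> insert i I" for j
    using that insert.prems by (intro integrable_ent_coordinate[OF M _ _ a]) auto
  \<comment> \<open>The entropy in coordinate \<open>i\<close> ignores the current value at
    \<open>i\<close>, so integrating over that value as well changes nothing.\<close>
  have last: "(\<integral>x. ent (M i) (\<lambda>y. Y (x(i := y))) \<partial>PiM I M)
      = (\<integral>w. ent (M i) (\<lambda>z. Y (w(i := z))) \<partial>PiM (insert i I) M)"
    by (subst ins) (auto simp: int_j Mi.prob_space)
  have rest: "(\<integral>x. ent (M j) (\<lambda>z. Z (x(j := z))) \<partial>PiM I M)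
      \<le> (\<integral>w. ent (M j) (\<lambda>z. Y (w(j := z))) \<partial>PiM (insert i I) M)" if j: "j \<in> I" for j
  proof -
    interpret Mj: prob_space "M j" by (rule M)
    have ij: "j \<noteq> i" using j insert.hyps by auto
    have sp: "x(j := z) \<in> space (PiM I M)" if "x \<in> space (PiM I M)" "z \<in> space (M j)" for x z
      using j that by (rule fun_upd_space_PiM_same)
    have "(\<integral>x. ent (M j) (\<lambda>z. Z (x(j := z))) \<partial>PiM I M)
        \<le> (\<integral>x. (\<integral>y. ent (M j) (\<lambda>z. Y ((x(i := y))(j := z))) \<partial>M i) \<partial>PiM I M)"
    proof (rule integral_mono)
      show "integrable (PiM I M) (\<lambda>x. ent (M j) (\<lambda>z. Z (x(j := z))))"
        using j Zb by (intro integrable_ent_coordinate[OF M _ _ a]) auto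
      have bnd: "\<bar>ent (M j) (\<lambda>z. Y ((x(i := y))(j := z)))\<bar> \<le> K"
        if "x \<in> space (PiM I M)" "y \<in> space (M i)" for x y
        unfolding K_def
      proof (intro Mj.abs_ent_le a)
        have w: "x(i := y) \<in> space (PiM (insert i I) M)" using that by (rule fun_upd_space_PiM)
        show "(\<lambda>z. Y ((x(i := y))(j := z))) \<in> borel_measurable (M j)"
          using measurable_compose[OF measurable_Pair1'[OF w] upd[of j]] j by simp
        fix z assume "z \<in> space (M j)"
        then show "a \<le> Y ((x(i := y))(j := z)) \<and> Y ((x(i := y))(j := z)) \<le> b"
          using fun_upd_space_PiM_same[OF _ w, of j z] j insert.prems(2) by simp
      qed
      have me: "(\<lambda>(x, y). ent (M j) (\<lambda>z. Y ((x(i := y))(j := z)))) \<in> borel_measurable (PiM I M \<Otimes>\<^sub>M M i)"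
        using measurable_compose[OF measurable_add_dim borel_measurable_integrable[OF int_j[of j]]] j
        by (simp add: case_prod_beta)
      show "integrable (PiM I M) (\<lambda>x. \<integral>y. ent (M j) (\<lambda>z. Y ((x(i := y))(j := z))) \<partial>M i)"
      proof (rule PI.integrable_between)
        show "(\<lambda>x. \<integral>y. ent (M j) (\<lambda>z. Y ((x(i := y))(j := z))) \<partial>M i) \<in> borel_measurable (PiM I M)"
          using me by (rule sigma_finite_measure.borel_measurable_lebesgue_integral[OF prob_space_imp_sigma_finite[OF M]])
        show "- K \<le> (\<integral>y. ent (M j) (\<lambda>z. Y ((x(i := y))(j := z))) \<partial>M i)
            \<and> (\<integral>y. ent (M j) (\<lambda>z. Y ((x(i := y))(j := z))) \<partial>M i) \<le> K"
          if x: "x \<in> space (PiM I M)" for x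
        proof (intro Mi.integral_between)
          show "(\<lambda>y. ent (M j) (\<lambda>z. Y ((x(i := y))(j := z)))) \<in> borel_measurable (M i)"
            using x measurable_compose[OF measurable_Pair1' me] by simp
        qed (use bnd[OF x] in \<open>auto simp: abs_le_iff minus_le_iff\<close>)
      qed
      fix x assume x: "x \<in> space (PiM I M)"
      have tw: "(x(i := y))(j := z) = (x(j := z))(i := y)" for y z
        using ij by (simp add: fun_upd_twist)
      show "ent (M j) (\<lambda>z. Z (x(j := z))) \<le> (\<integral>y. ent (M j) (\<lambda>z. Y ((x(i := y))(j := z))) \<partial>M i)"
        unfolding Z_def tw
      proof (rule ent_integral_le[OF M M _ a])
        have "(\<lambda>y. x(i := y)) \<in> measurable (M i) (PiM (insert i I) M)"
          using measurable_compose[OF measurable_Pair1'[OF x] measurable_add_dim] by simp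
        then have "(\<lambda>(y, z). (x(i := y), z)) \<in> measurable (M i \<Otimes>\<^sub>M M j) (PiM (insert i I) M \<Otimes>\<^sub>M M j)"
          by measurable
        from measurable_compose[OF this upd[of j]] j
        show "(\<lambda>(y, z). Y ((x(j := z))(i := y))) \<in> borel_measurable (M i \<Otimes>\<^sub>M M j)"
          by (simp add: case_prod_beta tw)
        show "a \<le> Y ((x(j := z))(i := y)) \<and> Y ((x(j := z))(i := y)) \<le> b"
          if "y \<in> space (M i)" "z \<in> space (M j)" for y z
          using that by (intro Yb sp[OF x])
      qed
    qed
    also have "\<dots> = (\<integral>w. ent (M j) (\<lambda>z. Y (w(j := z))) \<partial>PiM (insert i I) M)"
      using j by (subst ins) (auto intro!: int_j)
    finally show ?thesis .
  qed
  have "ent (PiM I M) Z \<le> (\<Sum>j\<in>I. \<integral>x. ent (M j) (\<lambda>z. Z (x(j := z))) \<partial>PiM I M)"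
    using Zb by (intro insert.IH) auto
  also have "\<dots> \<le> (\<Sum>j\<in>I. \<integral>w. ent (M j) (\<lambda>z. Y (w(j := z))) \<partial>PiM (insert i I) M)"
    by (intro sum_mono rest)
  finally show ?case
    unfolding chain last using insert.hyps by (simp add: fun_upd_def)
qed

text \<open>The inner integral does not depend on \<open>x i\<close>, so integrating over the old
  value contributes a factor one and Fubini gives the rest. Thanks to this, the coordinatewise
  bounds after tensorization become copies of one integral.\<close>

lemma integral_resample_coordinate:
  fixes M :: "'i \<Rightarrow> 'a measure" and \<phi> :: "('i \<Rightarrow> 'a) \<Rightarrow> real"
  assumes M: "\<And>i. prob_space (M i)" and I: "finite I" "i \<in> I"
    and \<phi>m: "\<phi> \<in> borel_measurable (PiM I M)"
    and \<phi>: "\<And>x. x \<in> space (PiM I M) \<Longrightarrow> a \<le> \<phi> x \<and> \<phi> x \<le> b"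
  shows "integrable (PiM I M) (\<lambda>x. \<integral>y. \<phi> (x(i := y)) \<partial>M i)"
    and "(\<integral>x. (\<integral>y. \<phi> (x(i := y)) \<partial>M i) \<partial>PiM I M) = (\<integral>x. \<phi> x \<partial>PiM I M)"
proof -
  interpret product_sigma_finite M
    using M by (simp add: product_sigma_finite_def prob_space_imp_sigma_finite)
  interpret P: prob_space "PiM I M" by (intro prob_space_PiM M)
  interpret Mi: prob_space "M i" by (rule M)
  have upd: "(\<lambda>(x, z). \<phi> (x(i := z))) \<in> borel_measurable (PiM I M \<Otimes>\<^sub>M M i)"
    using measurable_compose[OF measurable_fun_upd_coordinate[OF I(2)] \<phi>m]
    by (simp add: split_beta' fun_upd_def)
  show int: "integrable (PiM I M) (\<lambda>x. \<integral>y. \<phi> (x(i := y)) \<partial>M i)"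
  proof (rule P.integrable_between)
    show "(\<lambda>x. \<integral>y. \<phi> (x(i := y)) \<partial>M i) \<in> borel_measurable (PiM I M)"
      using upd
      by (rule sigma_finite_measure.borel_measurable_lebesgue_integral[OF prob_space_imp_sigma_finite[OF M]])
    fix x assume x: "x \<in> space (PiM I M)"
    show "a \<le> (\<integral>y. \<phi> (x(i := y)) \<partial>M i) \<and> (\<integral>y. \<phi> (x(i := y)) \<partial>M i) \<le> b"
    proof (rule Mi.integral_between)
      show "(\<lambda>y. \<phi> (x(i := y))) \<in> borel_measurable (M i)"
        using x measurable_compose[OF measurable_Pair1' upd] by simp
      show "a \<le> \<phi> (x(i := y)) \<and> \<phi> (x(i := y)) \<le> b" if "y \<in> space (M i)" for y
        using x I that by (intro \<phi> fun_upd_space_PiM_same)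
    qed
  qed
  define J where "J = I - {i}"
  have J: "I = insert i J" "finite J" "i \<notin> J" using I by (auto simp: J_def)
  have "(\<integral>x. (\<integral>y. \<phi> (x(i := y)) \<partial>M i) \<partial>PiM I M) = (\<integral>x. (\<integral>y. \<phi> (x(i := y)) \<partial>M i) \<partial>PiM J M)"
    using int unfolding J(1)
    by (subst product_integral_insert[OF J(2,3)]) (auto simp: Mi.prob_space)
  also have "\<dots> = (\<integral>x. \<phi> x \<partial>PiM I M)"
    using P.integrable_between[OF \<phi>m \<phi>] unfolding J(1)
    by (subst product_integral_insert[OF J(2,3)]) auto
  finally show "(\<integral>x. (\<integral>y. \<phi> (x(i := y)) \<partial>M i) \<partial>PiM I M) = (\<integral>x. \<phi> x \<partial>PiM I M)" .
qed

section \<open>Exponential moments from a self-bounding condition\<close>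

lemma exp_diff_mult_le:
  fixes u v :: real
  assumes "v \<le> u"
  shows "(exp u - exp v) * (u - v) \<le> (u - v)\<^sup>2 * exp u"
proof -
  have "exp u * (1 + (v - u)) \<le> exp u * exp (v - u)"
    by (intro mult_left_mono exp_ge_add_one_self) auto
  then have "exp u - exp v \<le> (u - v) * exp u"
    by (simp add: exp_diff algebra_simps)
  then have "(exp u - exp v) * (u - v) \<le> ((u - v) * exp u) * (u - v)"
    using assms by (intro mult_right_mono) auto
  then show ?thesis by (simp add: power2_eq_square mult_ac)
qed

text \<open>By Jensen, the entropy of \<open>exp \<circ> g\<close> is at most the covariance of \<open>exp \<circ> g\<close> and \<open>g\<close>,
  which is half the expectation of \<open>(exp (g y) - exp (g z)) * (g y - g z)\<close> over independent copies.\<close>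

lemma (in prob_space) ent_exp_le:
  assumes [measurable]: "g \<in> borel_measurable M" "\<kappa> \<in> borel_measurable M"
    and g: "\<And>x. x \<in> space M \<Longrightarrow> 0 \<le> g x \<and> g x \<le> B"
    and \<kappa>: "\<And>x. x \<in> space M \<Longrightarrow> 0 \<le> \<kappa> x \<and> \<kappa> x \<le> C"
    and diff: "\<And>y z. y \<in> space M \<Longrightarrow> z \<in> space M \<Longrightarrow> g z \<le> g y \<Longrightarrow> (g y - g z)\<^sup>2 \<le> \<kappa> y"
  shows "ent M (\<lambda>x. exp (g x)) \<le> (\<integral>x. \<kappa> x * exp (g x) \<partial>M)"
proof -
  have B0: "exp (g x) \<le> exp B" if "x \<in> space M" for x using g[OF that] by simp
  have ig [simp]: "integrable M g" using g by (intro integrable_between) auto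
  have ie [simp]: "integrable M (\<lambda>x. exp (g x))"
    using B0 by (intro integrable_between[where a=0 and b="exp B"]) auto
  have ige [simp]: "integrable M (\<lambda>x. exp (g x) * g x)"
    using B0 g by (intro integrable_between[where a=0 and b="exp B * B"]) (auto intro!: mult_mono')
  have ike [simp]: "integrable M (\<lambda>x. \<kappa> x * exp (g x))"
    using B0 \<kappa> by (intro integrable_between[where a=0 and b="C * exp B"])
      (auto intro!: mult_mono')
  define Eg where "Eg = (\<integral>x. g x \<partial>M)"
  define Ee where "Ee = (\<integral>x. exp (g x) \<partial>M)"
  define Ege where "Ege = (\<integral>x. exp (g x) * g x \<partial>M)"
  define Eke where "Eke = (\<integral>x. \<kappa> x * exp (g x) \<partial>M)"
  \<comment> \<open>Jensen, by integrating the tangent line of \<open>exp\<close> at the mean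
    \<open>Eg\<close>.\<close>
  have "(\<integral>x. exp Eg * (1 + (g x - Eg)) \<partial>M) \<le> Ee"
    unfolding Ee_def
  proof (rule integral_mono)
    fix x assume "x \<in> space M"
    have "exp Eg * (1 + (g x - Eg)) \<le> exp Eg * exp (g x - Eg)"
      by (intro mult_left_mono exp_ge_add_one_self) auto
    then show "exp Eg * (1 + (g x - Eg)) \<le> exp (g x)" by (simp add: exp_diff)
  qed auto
  then have jensen: "exp Eg \<le> Ee" by (simp add: Eg_def[symmetric] prob_space)
  then have Ee: "Ee > 0" by (rule less_le_trans[rotated]) simp
  have "Eg \<le> ln Ee" using jensen Ee by (simp add: ln_ge_iff)
  then have "ent M (\<lambda>x. exp (g x)) \<le> Ege - Ee * Eg"
    unfolding ent_def using Ee by (simp add: Ege_def[symmetric] Ee_def[symmetric])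
  moreover have "2 * (Ege - Ee * Eg) \<le> 2 * Eke"
  proof -
    have inner: "(\<integral>z. (exp (g y) - exp (g z)) * (g y - g z) \<partial>M)
        = exp (g y) * g y - exp (g y) * Eg - Ee * g y + Ege" for y
    proof -
      have "(\<integral>z. (exp (g y) - exp (g z)) * (g y - g z) \<partial>M)
          = (\<integral>z. exp (g y) * g y - exp (g y) * g z - exp (g z) * g y + exp (g z) * g z \<partial>M)"
        by (simp add: algebra_simps)
      then show ?thesis by (simp add: Eg_def Ee_def Ege_def prob_space)
    qed
    have "(\<integral>y. (\<integral>z. (exp (g y) - exp (g z)) * (g y - g z) \<partial>M) \<partial>M) = 2 * (Ege - Ee * Eg)"
      unfolding inner by (simp add: Eg_def[symmetric] Ee_def[symmetric] Ege_def[symmetric] prob_space)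
    moreover have "(\<integral>y. (\<integral>z. (exp (g y) - exp (g z)) * (g y - g z) \<partial>M) \<partial>M)
        \<le> (\<integral>y. (\<integral>z. \<kappa> y * exp (g y) + \<kappa> z * exp (g z) \<partial>M) \<partial>M)"
    proof (rule integral_mono)
      show "integrable M (\<lambda>y. \<integral>z. (exp (g y) - exp (g z)) * (g y - g z) \<partial>M)"
        unfolding inner by simp
      show "integrable M (\<lambda>y. \<integral>z. \<kappa> y * exp (g y) + \<kappa> z * exp (g z) \<partial>M)"
        by (simp add: prob_space)
      fix y assume y: "y \<in> space M"
      show "(\<integral>z. (exp (g y) - exp (g z)) * (g y - g z) \<partial>M)
          \<le> (\<integral>z. \<kappa> y * exp (g y) + \<kappa> z * exp (g z) \<partial>M)"
      proof (rule integral_mono)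
        show "integrable M (\<lambda>z. (exp (g y) - exp (g z)) * (g y - g z))"
          by (simp add: left_diff_distrib right_diff_distrib)
        fix z assume z: "z \<in> space M"
        \<comment> \<open>The hypothesis controls the difference by \<open>\<kappa>\<close> at the
          point where \<open>g\<close> is larger. Which point that is varies with the pair, so both
          terms are added; the resulting factor 2 matches the one in front of the
          covariance.\<close>
        have half: "(exp (g u) - exp (g v)) * (g u - g v) \<le> \<kappa> u * exp (g u)"
          if "u \<in> space M" "v \<in> space M" "g v \<le> g u" for u v
          by (rule order_trans[OF exp_diff_mult_le[OF that(3)] mult_right_mono[OF diff[OF that]]]) simp
        have "0 \<le> \<kappa> y * exp (g y)" "0 \<le> \<kappa> z * exp (g z)" using \<kappa> y z by auto
        moreover have "(exp (g z) - exp (g y)) * (g z - g y) = (exp (g y) - exp (g z)) * (g y - g z)"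
          by (simp add: algebra_simps)
        ultimately show "(exp (g y) - exp (g z)) * (g y - g z) \<le> \<kappa> y * exp (g y) + \<kappa> z * exp (g z)"
          using half[of y z] half[of z y] y z by (cases "g z \<le> g y") linarith+
      qed simp
    qed
    moreover have "(\<integral>y. (\<integral>z. \<kappa> y * exp (g y) + \<kappa> z * exp (g z) \<partial>M) \<partial>M) = 2 * Eke"
      by (simp add: Eke_def[symmetric] prob_space)
    ultimately show ?thesis by linarith
  qed
  ultimately show ?thesis by (simp add: Eke_def)
qed

text \<open>In each coordinate \<open>ent_exp_le\<close> is applied to \<open>l * f\<close> with the
  bound \<open>l\<^sup>2 * d * f\<close>. Because this bound is a multiple of \<open>f\<close>
  itself, the integral on the right is the derivative in \<open>l\<close> of the mean of
  \<open>exp (l * f)\<close>, and the inequality closes on that one function of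
  \<open>l\<close>.\<close>

lemma self_bounding_entropy_le:
  fixes f :: "('i \<Rightarrow> 'a) \<Rightarrow> real"
  assumes M: "\<And>i. prob_space (M i)" and I: "finite I"
    and fm: "f \<in> borel_measurable (PiM I M)"
    and f: "\<And>x. x \<in> space (PiM I M) \<Longrightarrow> 0 \<le> f x \<and> f x \<le> B"
    and d: "0 \<le> d" and l: "0 \<le> l"
    and self: "\<And>i x y z. i \<in> I \<Longrightarrow> x \<in> space (PiM I M) \<Longrightarrow> y \<in> space (M i) \<Longrightarrow> z \<in> space (M i)
      \<Longrightarrow> f (x(i := z)) \<le> f (x(i := y)) \<Longrightarrow> (f (x(i := y)) - f (x(i := z)))\<^sup>2 \<le> d * f (x(i := y))"
  shows "ent (PiM I M) (\<lambda>x. exp (l * f x)) \<le> real (card I) * d * l\<^sup>2 * (\<integral>x. f x * exp (l * f x) \<partial>PiM I M)"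
proof -
  note [measurable] = fm
  define \<phi> where "\<phi> = (\<lambda>x. (l\<^sup>2 * d * f x) * exp (l * f x))"
  have ex: "1 \<le> exp (l * f x) \<and> exp (l * f x) \<le> exp (l * B)" if "x \<in> space (PiM I M)" for x
    using f[OF that] l by (auto intro!: mult_left_mono)
  have \<phi>b: "0 \<le> \<phi> x \<and> \<phi> x \<le> (l\<^sup>2 * d * B) * exp (l * B)" if "x \<in> space (PiM I M)" for x
    unfolding \<phi>_def using f[OF that] ex[OF that] d
    by (auto intro!: mult_mono' mult_left_mono)
  have \<phi>m [measurable]: "\<phi> \<in> borel_measurable (PiM I M)" unfolding \<phi>_def by measurable
  have "ent (PiM I M) (\<lambda>x. exp (l * f x))
      \<le> (\<Sum>i\<in>I. \<integral>x. ent (M i) (\<lambda>y. exp (l * f (x(i := y)))) \<partial>PiM I M)"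
    using ex by (intro ent_tensorization[OF M I, where a=1 and b="exp (l * B)"]) auto
  also have "\<dots> \<le> (\<Sum>i\<in>I. \<integral>x. \<phi> x \<partial>PiM I M)"
  proof (rule sum_mono)
    fix i assume i: "i \<in> I"
    interpret Mi: prob_space "M i" by (rule M)
    have upd: "(\<lambda>(x, z). f (x(i := z))) \<in> borel_measurable (PiM I M \<Otimes>\<^sub>M M i)"
      using measurable_compose[OF measurable_fun_upd_coordinate[OF i] fm]
      by (simp add: split_beta' fun_upd_def)
    have "(\<integral>x. ent (M i) (\<lambda>y. exp (l * f (x(i := y)))) \<partial>PiM I M)
        \<le> (\<integral>x. (\<integral>y. \<phi> (x(i := y)) \<partial>M i) \<partial>PiM I M)"
    proof (rule integral_mono)
      show "integrable (PiM I M) (\<lambda>x. ent (M i) (\<lambda>y. exp (l * f (x(i := y)))))"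
        using ex i by (intro integrable_ent_coordinate[OF M, where a=1 and b="exp (l * B)"]) auto
      show "integrable (PiM I M) (\<lambda>x. \<integral>y. \<phi> (x(i := y)) \<partial>M i)"
        by (rule integral_resample_coordinate(1)[OF M I i \<phi>m \<phi>b])
      fix x assume x: "x \<in> space (PiM I M)"
      have [measurable]: "(\<lambda>y. f (x(i := y))) \<in> borel_measurable (M i)"
        using x measurable_compose[OF measurable_Pair1' upd] by simp
      have fx: "0 \<le> f (x(i := y)) \<and> f (x(i := y)) \<le> B" if "y \<in> space (M i)" for y
        using i x that by (intro f fun_upd_space_PiM_same)
      show "ent (M i) (\<lambda>y. exp (l * f (x(i := y)))) \<le> (\<integral>y. \<phi> (x(i := y)) \<partial>M i)"
        unfolding \<phi>_def
      proof (rule Mi.ent_exp_le)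
        show "0 \<le> l * f (x(i := y)) \<and> l * f (x(i := y)) \<le> l * B" if "y \<in> space (M i)" for y
          using fx[OF that] l by (auto intro!: mult_left_mono)
        show "0 \<le> l\<^sup>2 * d * f (x(i := y)) \<and> l\<^sup>2 * d * f (x(i := y)) \<le> l\<^sup>2 * d * B" if "y \<in> space (M i)" for y
          using fx[OF that] l d by (auto intro!: mult_left_mono)
        fix y z assume yz: "y \<in> space (M i)" "z \<in> space (M i)" "l * f (x(i := z)) \<le> l * f (x(i := y))"
        show "(l * f (x(i := y)) - l * f (x(i := z)))\<^sup>2 \<le> l\<^sup>2 * d * f (x(i := y))"
        proof (cases "l = 0")
          case False
          then have "f (x(i := z)) \<le> f (x(i := y))" using yz(3) l by simp
          then have "l\<^sup>2 * (f (x(i := y)) - f (x(i := z)))\<^sup>2 \<le> l\<^sup>2 * (d * f (x(i := y)))"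
            using self[OF i x yz(1,2)] by (intro mult_left_mono) auto
          then show ?thesis by (simp add: power_mult_distrib[symmetric] right_diff_distrib mult.assoc)
        qed simp
      qed measurable
    qed
    also have "\<dots> = (\<integral>x. \<phi> x \<partial>PiM I M)"
      by (rule integral_resample_coordinate(2)[OF M I i \<phi>m \<phi>b])
    finally show "(\<integral>x. ent (M i) (\<lambda>y. exp (l * f (x(i := y)))) \<partial>PiM I M) \<le> (\<integral>x. \<phi> x \<partial>PiM I M)" .
  qed
  also have "(\<integral>x. \<phi> x \<partial>PiM I M) = l\<^sup>2 * d * (\<integral>x. f x * exp (l * f x) \<partial>PiM I M)"
    unfolding \<phi>_def by (simp add: mult.assoc)
  finally show ?thesis by (simp add: mult_ac)
qed

text \<open>Halving the parameter replaces Herbst's differential argument: along \<open>l / 2 ^ k\<close> the quantity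
  \<open>(1 - 2 * a * l) * ln F l / l\<close> increases, and for large \<open>k\<close> it is at most twice the mean of \<open>f\<close>.\<close>

lemma (in prob_space) exp_moment_le_of_entropy:
  assumes [measurable]: "f \<in> borel_measurable M"
    and f: "\<And>x. x \<in> space M \<Longrightarrow> 0 \<le> f x \<and> f x \<le> B"
    and a: "0 \<le> a" and l0: "0 < l0" "a * l0 \<le> 1 / 3"
    and ent: "\<And>l. 0 \<le> l \<Longrightarrow> ent M (\<lambda>x. exp (l * f x)) \<le> a * l\<^sup>2 * (\<integral>x. f x * exp (l * f x) \<partial>M)"
  shows "(\<integral>x. exp (l0 * f x) \<partial>M) \<le> exp (6 * l0 * (\<integral>x. f x \<partial>M))"
proof -
  define F where "F = (\<lambda>l. \<integral>x. exp (l * f x) \<partial>M)"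
  define D where "D = (\<lambda>l. \<integral>x. f x * exp (l * f x) \<partial>M)"
  define G where "G = (\<lambda>l. ln (F l))"
  have ex: "1 \<le> exp (l * f x) \<and> exp (l * f x) \<le> exp (l * B)" if "x \<in> space M" "0 \<le> l" for x l
    using f[OF that(1)] that(2) by (auto intro!: mult_left_mono)
  have ie [simp]: "integrable M (\<lambda>x. exp (l * f x))" if "0 \<le> l" for l
    using ex that by (intro integrable_between[where a=1 and b="exp (l * B)"]) auto
  have ife [simp]: "integrable M (\<lambda>x. f x * exp (l * f x))" if "0 \<le> l" for l
    using ex[OF _ that] f that by (intro integrable_between[where a=0 and b="B * exp (l * B)"])
      (auto intro!: mult_mono')
  have if' [simp]: "integrable M f" using f by (intro integrable_between) auto
  have F1: "1 \<le> F l" if "0 \<le> l" for l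
    using integral_between[of "\<lambda>x. exp (l * f x)" 1 "exp (l * B)"] ex that by (auto simp: F_def)
  have D0: "0 \<le> D l" if "0 \<le> l" for l
    unfolding D_def using f by (intro integral_nonneg_AE AE_I2) auto
  \<comment> \<open>Let \<open>m\<close> be the logarithmic derivative \<open>D l / F l\<close>. The
    entropy hypothesis gives \<open>(1 - a * l) * (l * m) \<le> G l\<close>, and convexity of
    \<open>G\<close> gives \<open>2 * G l - 2 * G (l / 2) \<le> l * m\<close>; eliminating
    \<open>m\<close> yields the claim.\<close>
  have step: "(1 - 2 * a * l) * G l \<le> (1 - a * l) * (2 * G (l / 2))" if l: "0 < l" "a * l \<le> 1" for l
  proof -
    have Fp: "F l > 0" "F (l / 2) > 0" using F1[of l] F1[of "l / 2"] l by auto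
    define m where "m = D l / F l"
    have "l * D l - F l * G l \<le> a * l\<^sup>2 * D l"
    proof -
      have "ent M (\<lambda>x. exp (l * f x)) = l * D l - F l * G l"
        using l by (simp add: ent_def D_def F_def G_def mult_ac)
      then show ?thesis using ent[of l] l by (simp add: D_def)
    qed
    then have "(l * D l - F l * G l) / F l \<le> a * l\<^sup>2 * D l / F l"
      using Fp by (intro divide_right_mono) auto
    then have 1: "(1 - a * l) * (l * m) \<le> G l"
      using Fp by (simp add: m_def diff_divide_distrib algebra_simps power2_eq_square)
    have Fl: "(\<integral>x. exp (l * f x) \<partial>M) = F l" and Dl: "(\<integral>x. f x * exp (l * f x) \<partial>M) = D l"
      by (simp_all add: F_def D_def)
    \<comment> \<open>Jensen under the law tilted by \<open>exp (l * f) / F l\<close>, for which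
      \<open>f\<close> has mean \<open>m\<close>. The bound is \<open>1 + z \<le> exp z\<close> at
      \<open>z = l * (m - f) / 2\<close>, and the tilted mean of \<open>z\<close> is zero.\<close>
    have "F l * exp (- l * m / 2) = (\<integral>x. exp (- l * m / 2) * ((1 + l * m / 2) * exp (l * f x) - l / 2 * (f x * exp (l * f x))) \<partial>M)"
      using l Fp by (simp add: Fl Dl) (simp add: m_def field_simps)
    also have "\<dots> \<le> F (l / 2)"
      unfolding F_def
    proof (rule integral_mono)
      show "integrable M (\<lambda>x. exp (l / 2 * f x))" using l by (intro ie) simp
      fix x assume x: "x \<in> space M"
      have "exp (- l * m / 2) * exp (l * f x) * (1 + (l * m / 2 - l / 2 * f x))
          \<le> exp (- l * m / 2) * exp (l * f x) * exp (l * m / 2 - l / 2 * f x)"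
        by (intro mult_left_mono exp_ge_add_one_self) auto
      also have "\<dots> = exp (l / 2 * f x)"
        by (simp add: exp_add[symmetric])
      finally show "exp (- l * m / 2) * ((1 + l * m / 2) * exp (l * f x) - l / 2 * (f x * exp (l * f x)))
          \<le> exp (l / 2 * f x)"
        by (simp add: algebra_simps)
    qed (use l in auto)
    finally have "ln (F l * exp (- l * m / 2)) \<le> ln (F (l / 2))"
      using Fp by simp
    then have "2 * G l - 2 * G (l / 2) \<le> l * m"
      using Fp by (simp add: G_def ln_mult_pos)
    then have "(1 - a * l) * (2 * G l - 2 * G (l / 2)) \<le> (1 - a * l) * (l * m)"
      using l by (intro mult_left_mono) auto
    with 1 show ?thesis by (simp add: algebra_simps)
  qed
  \<comment> \<open>The factor \<open>1 - a * l\<close> in \<open>step\<close> is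
    \<open>1 - 2 * a * (l / 2)\<close>, so it becomes the prefactor of the next term of the
    sequence.\<close>
  define T where "T = (\<lambda>k. (1 - 2 * a * (l0 / 2 ^ k)) * (2 ^ k * G (l0 / 2 ^ k)))"
  have al: "a * (l0 / 2 ^ k) \<le> 1 / 3" for k
  proof -
    have "l0 / 2 ^ k \<le> l0" using l0 by (simp add: divide_le_eq)
    then have "a * (l0 / 2 ^ k) \<le> a * l0" using a by (intro mult_left_mono)
    then show ?thesis using l0(2) by linarith
  qed
  have T: "T 0 \<le> T k" for k
  proof (induction k)
    case (Suc k)
    have "(1 - 2 * a * (l0 / 2 ^ k)) * G (l0 / 2 ^ k) \<le> (1 - a * (l0 / 2 ^ k)) * (2 * G (l0 / 2 ^ k / 2))"
    proof (rule step)
      show "a * (l0 / 2 ^ k) \<le> 1" using al[of k] by linarith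
    qed (use l0 in simp)
    then have "2 ^ k * ((1 - 2 * a * (l0 / 2 ^ k)) * G (l0 / 2 ^ k))
        \<le> 2 ^ k * ((1 - a * (l0 / 2 ^ k)) * (2 * G (l0 / 2 ^ k / 2)))"
      by (intro mult_left_mono) auto
    moreover have "l0 / 2 ^ Suc k = l0 / 2 ^ k / 2" by simp
    ultimately have "T k \<le> T (Suc k)" by (simp add: T_def mult_ac)
    with Suc show ?case by simp
  qed simp
  \<comment> \<open>After \<open>N\<close> halvings \<open>l * f\<close> is at most 1, where
    \<open>exp z \<le> 1 + z + z\<^sup>2 \<le> 1 + 2 * z\<close>. This is the 2 in the constant 6;
    the 3 is the inverse of the lower bound \<open>1 / 3\<close> for
    \<open>1 - 2 * a * l0\<close>.\<close>
  obtain N where N: "l0 * B < 2 ^ N" using real_arch_pow[of 2 "l0 * B"] by auto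
  define l where "l = l0 / 2 ^ N"
  have l: "0 < l" using l0 by (simp add: l_def)
  have lB: "l * B \<le> 1" using N by (simp add: l_def divide_le_eq)
  have "F l \<le> (\<integral>x. 1 + 2 * l * f x \<partial>M)"
    unfolding F_def
  proof (rule integral_mono)
    fix x assume x: "x \<in> space M"
    have "0 \<le> l * f x" using f[OF x] l by simp
    moreover have "l * f x \<le> l * B" using f[OF x] l by (intro mult_left_mono) auto
    then have "l * f x \<le> 1" using lB by linarith
    ultimately have "exp (l * f x) \<le> 1 + l * f x + (l * f x)\<^sup>2" "(l * f x)\<^sup>2 \<le> l * f x"
      using exp_bound[of "l * f x"] mult_left_le[of "l * f x" "l * f x"]
      by (simp_all add: power2_eq_square)
    then show "exp (l * f x) \<le> 1 + 2 * l * f x" by simp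
  qed (use l in auto)
  also have "\<dots> = 1 + 2 * l * (\<integral>x. f x \<partial>M)" by (simp add: prob_space)
  finally have "F l \<le> 1 + 2 * l * (\<integral>x. f x \<partial>M)" .
  then have Gl: "G l \<le> 2 * l * (\<integral>x. f x \<partial>M)"
    unfolding G_def using ln_le_minus_one[of "F l"] F1[of l] l by auto
  have "T N \<le> 1 * (2 ^ N * G l)"
    unfolding T_def l_def[symmetric] using a l F1[of l]
    by (intro mult_right_mono) (auto simp: G_def)
  also have "\<dots> \<le> 2 ^ N * (2 * l * (\<integral>x. f x \<partial>M))" using Gl by (simp add: mult_left_mono)
  also have "\<dots> = 2 * l0 * (\<integral>x. f x \<partial>M)" by (simp add: l_def)
  finally have "T 0 \<le> 2 * l0 * (\<integral>x. f x \<partial>M)" using T[of N] by simp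
  moreover have "1 / 3 * G l0 \<le> T 0"
  proof -
    have "1 / 3 \<le> 1 - 2 * a * l0" using l0(2) by simp
    moreover have "0 \<le> G l0" using F1[of l0] l0 by (simp add: G_def)
    ultimately have "1 / 3 * G l0 \<le> (1 - 2 * a * l0) * G l0" by (rule mult_right_mono)
    then show ?thesis by (simp add: T_def)
  qed
  ultimately have "G l0 \<le> 6 * l0 * (\<integral>x. f x \<partial>M)" by simp
  then have "exp (G l0) \<le> exp (6 * l0 * (\<integral>x. f x \<partial>M))" by simp
  moreover have "exp (G l0) = F l0" using F1[of l0] l0 by (simp add: G_def)
  ultimately show ?thesis by (simp add: F_def)
qed

section \<open>Gaussian posteriors and the PAC-Bayes bound\<close>

definition gauss_density :: "real \<Rightarrow> 'h::euclidean_space \<Rightarrow> 'h \<Rightarrow> real" where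
  "gauss_density \<sigma> a h = (2 * pi * \<sigma>\<^sup>2) powr (- real DIM('h) / 2) * exp (- (norm (h - a))\<^sup>2 / (2 * \<sigma>\<^sup>2))"

lemma gauss_post_eq: "gauss_post \<sigma> a = density lborel (\<lambda>h. ennreal (gauss_density \<sigma> a h))"
  by (simp add: gauss_post_def gauss_density_def)

lemma gauss_density_pos: "\<sigma> > 0 \<Longrightarrow> gauss_density \<sigma> a h > 0"
  by (simp add: gauss_density_def)

lemma measurable_gauss_density [measurable]:
  fixes f g :: "'a \<Rightarrow> 'h::euclidean_space"
  assumes [measurable]: "f \<in> borel_measurable M" "g \<in> borel_measurable M"
  shows "(\<lambda>x. gauss_density \<sigma> (f x) (g x)) \<in> borel_measurable M"
  unfolding gauss_density_def by measurable

text \<open>The squared norm is a sum over \<open>Basis\<close>; the total mass then follows from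
  one-dimensional normal densities and the product structure of \<open>lborel\<close>.\<close>

lemma gauss_density_eq_prod:
  fixes a h :: "'h::euclidean_space"
  assumes "\<sigma> > 0"
  shows "gauss_density \<sigma> a h = (\<Prod>b\<in>Basis. normal_density (a \<bullet> b) \<sigma> (h \<bullet> b))"
proof -
  define c where "c = 2 * pi * \<sigma>\<^sup>2"
  have c: "c > 0" using assms by (simp add: c_def)
  have "1 / sqrt c = c powr (- 1 / 2)"
    using c by (simp add: powr_half_sqrt[symmetric] powr_minus_divide)
  then have "(1 / sqrt c) ^ DIM('h) = c powr (- real DIM('h) / 2)"
    using c by (simp add: powr_power)
  moreover have "(norm (h - a))\<^sup>2 = (\<Sum>b\<in>Basis. (h \<bullet> b - a \<bullet> b)\<^sup>2)"
    unfolding power2_norm_eq_inner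
    by (subst euclidean_inner) (simp add: power2_eq_square inner_diff_left)
  then have "exp (- (norm (h - a))\<^sup>2 / (2 * \<sigma>\<^sup>2)) = (\<Prod>b\<in>Basis. exp (- (h \<bullet> b - a \<bullet> b)\<^sup>2 / (2 * \<sigma>\<^sup>2)))"
    by (simp add: exp_sum[symmetric] sum_divide_distrib sum_negf)
  ultimately show ?thesis
    by (simp only: gauss_density_def normal_density_def prod.distrib prod_constant c_def)
qed

lemma nn_integral_gauss_density:
  assumes "\<sigma> > 0"
  shows "(\<integral>\<^sup>+h. ennreal (gauss_density \<sigma> a h) \<partial>lborel) = 1"
proof -
  have one: "(\<integral>\<^sup>+x. ennreal (normal_density \<mu> \<sigma> x) \<partial>lborel) = 1" for \<mu>
    using assms by (subst nn_integral_eq_integral) auto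
  have "(\<integral>\<^sup>+h. ennreal (gauss_density \<sigma> a h) \<partial>lborel)
      = (\<integral>\<^sup>+h. (\<Prod>b\<in>Basis. ennreal (normal_density (a \<bullet> b) \<sigma> (h \<bullet> b))) \<partial>lborel)"
    using assms by (simp add: gauss_density_eq_prod prod_ennreal)
  also have "\<dots> = 1"
    by (subst nn_integral_lborel_prod) (auto simp: one)
  finally show ?thesis .
qed

lemma prob_space_gauss_post:
  assumes "\<sigma> > 0"
  shows "prob_space (gauss_post \<sigma> a)"
  unfolding gauss_post_eq using assms
  by (intro prob_spaceI) (simp add: emeasure_density nn_integral_gauss_density)

text \<open>The chi-square integral of two Gaussians with the same variance: completing the square gives
  again a Gaussian, centred at \<open>2 a - b\<close>.\<close>

lemma gauss_density_square_div:
  fixes a b h :: "'h::euclidean_space"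
  assumes "\<sigma> > 0"
  shows "(gauss_density \<sigma> a h)\<^sup>2 / gauss_density \<sigma> b h
    = exp ((norm (a - b))\<^sup>2 / \<sigma>\<^sup>2) * gauss_density \<sigma> (2 *\<^sub>R a - b) h"
proof -
  define C where "C = (2 * pi * \<sigma>\<^sup>2) powr (- real DIM('h) / 2)"
  define v where "v = 2 * \<sigma>\<^sup>2"
  have C: "C > 0" and v: "v > 0" using assms by (auto simp: C_def v_def)
  have sq: "- 2 * (norm (h - a))\<^sup>2 + (norm (h - b))\<^sup>2 = 2 * (norm (a - b))\<^sup>2 - (norm (h - (2 *\<^sub>R a - b)))\<^sup>2"
    unfolding power2_norm_eq_inner by (simp add: inner_diff_left inner_diff_right inner_commute algebra_simps)
  have "(C * exp (- (norm (h - a))\<^sup>2 / v))\<^sup>2 / (C * exp (- (norm (h - b))\<^sup>2 / v))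
      = C * (exp (- (norm (h - a))\<^sup>2 / v) * exp (- (norm (h - a))\<^sup>2 / v) * exp ((norm (h - b))\<^sup>2 / v))"
    using C by (simp add: power2_eq_square field_simps exp_minus)
  also have "\<dots> = C * exp ((- 2 * (norm (h - a))\<^sup>2 + (norm (h - b))\<^sup>2) / v)"
    by (simp add: exp_add[symmetric] add_divide_distrib diff_divide_distrib)
  also have "\<dots> = exp (2 * (norm (a - b))\<^sup>2 / v) * (C * exp (- (norm (h - (2 *\<^sub>R a - b)))\<^sup>2 / v))"
    unfolding sq by (simp add: exp_add[symmetric] diff_divide_distrib)
  finally show ?thesis
    by (simp add: gauss_density_def C_def v_def)
qed

lemma nn_integral_gauss_density_square_div:
  assumes "\<sigma> > 0"
  shows "(\<integral>\<^sup>+h. ennreal ((gauss_density \<sigma> a h)\<^sup>2 / gauss_density \<sigma> b h) \<partial>lborel)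
    = ennreal (exp ((norm (a - b))\<^sup>2 / \<sigma>\<^sup>2))"
  unfolding gauss_density_square_div[OF assms]
  by (simp add: ennreal_mult' nn_integral_cmult nn_integral_gauss_density assms)

text \<open>Expand \<open>(t * v * w - u)\<^sup>2 \<ge> 0\<close> with
  \<open>w = exp (c / 2 * kl)\<close> and divide by \<open>2 * t * v\<close>. Unlike an integrated
  Cauchy--Schwarz inequality, this pointwise form needs no finite integrals, covers infinite
  \<open>kl\<close>, and leaves \<open>t\<close> to be optimized after integration.\<close>

lemma exp_kl_mult_le:
  assumes "u \<ge> 0" "v > 0" "t > 0"
  shows "ennreal u * exp_kl (c / 2) s p \<le> ennreal (t / 2 * v) * exp_kl c s p + ennreal (1 / (2 * t)) * ennreal (u\<^sup>2 / v)"
proof (cases "kl s p = \<top>")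
  case True
  then show ?thesis using assms by (simp add: exp_kl_def ennreal_mult_top)
next
  case False
  define w where "w = exp (c / 2 * enn2real (kl s p))"
  have w2: "exp (c * enn2real (kl s p)) = w\<^sup>2"
    by (simp add: w_def power2_eq_square exp_add[symmetric])
  have w: "w > 0" by (simp add: w_def)
  have "0 \<le> (t * v * w - u)\<^sup>2 / (2 * t * v)" using assms by simp
  also have "\<dots> = t / 2 * v * w\<^sup>2 + 1 / (2 * t) * (u\<^sup>2 / v) - u * w"
    using assms by (simp add: field_simps power2_eq_square)
  finally have "u * w \<le> t / 2 * v * w\<^sup>2 + 1 / (2 * t) * (u\<^sup>2 / v)" by simp
  then have "ennreal (u * w) \<le> ennreal (t / 2 * v * w\<^sup>2 + 1 / (2 * t) * (u\<^sup>2 / v))"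
    by (rule ennreal_leI)
  also have "\<dots> = ennreal (t / 2 * v) * ennreal (w\<^sup>2) + ennreal (1 / (2 * t)) * ennreal (u\<^sup>2 / v)"
    using assms w by (simp add: ennreal_plus ennreal_mult[symmetric])
  finally have "ennreal u * ennreal w
      \<le> ennreal (t / 2 * v) * ennreal (w\<^sup>2) + ennreal (1 / (2 * t)) * ennreal (u\<^sup>2 / v)"
    using assms w by (simp add: ennreal_mult)
  moreover have "exp_kl (c / 2) s p = ennreal w" "exp_kl c s p = ennreal (w\<^sup>2)"
    using False by (simp_all only: exp_kl_def w2 w_def if_False)
  ultimately show ?thesis by simp
qed

section \<open>Sensitivity and the exponential moment of the squared deviation\<close>

lemma hyp_sens_bound:
  fixes A :: "(nat \<Rightarrow> 'x) \<Rightarrow> 'h::real_normed_vector"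
  assumes "prob_space \<mu>" and n: "n > 0"
    and le: "ereal (12 * real n) * (hyp_sens n \<mu> A)\<^sup>2 \<le> ereal (\<sigma>\<^sup>2)"
  obtains c where "0 \<le> c" "12 * real n * c\<^sup>2 \<le> \<sigma>\<^sup>2"
    "\<And>k x y y'. k < n \<Longrightarrow> x \<in> space (sample_space n \<mu>) \<Longrightarrow> y \<in> space \<mu> \<Longrightarrow> y' \<in> space \<mu>
      \<Longrightarrow> norm (A (x(k := y)) - A (x(k := y'))) \<le> c"
proof -
  interpret prob_space \<mu> by fact
  interpret P: prob_space "sample_space n \<mu>" by (intro prob_space_PiM assms(1))
  have up: "ereal (norm (A (x(k := y)) - A (x(k := y')))) \<le> hyp_sens n \<mu> A"
    if "k < n" "x \<in> space (sample_space n \<mu>)" "y \<in> space \<mu>" "y' \<in> space \<mu>" for k x y y'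
    unfolding hyp_sens_def using that
    by (intro SUP_upper2[of k] SUP_upper2[of x] SUP_upper2[of y] SUP_upper2[of y']) auto
  obtain x0 y0 where x0: "x0 \<in> space (sample_space n \<mu>)" "y0 \<in> space \<mu>"
    using not_empty P.not_empty by blast
  \<comment> \<open>The coefficient is extended-valued. Comparing a point with itself bounds it
    below by 0, and the sensitivity condition excludes infinity, so it is a real number
    \<open>c\<close>.\<close>
  have "0 \<le> hyp_sens n \<mu> A"
    using up[OF n x0(1,2,2)] by (simp add: zero_ereal_def)
  moreover have "hyp_sens n \<mu> A \<noteq> \<infinity>"
    using le n by auto
  ultimately obtain c where c: "hyp_sens n \<mu> A = ereal c" "0 \<le> c"
    by (cases "hyp_sens n \<mu> A") auto
  show thesis
  proof (rule that[of c])
    show "12 * real n * c\<^sup>2 \<le> \<sigma>\<^sup>2" using le by (simp add: c)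
    show "norm (A (x(k := y)) - A (x(k := y'))) \<le> c"
      if "k < n" "x \<in> space (sample_space n \<mu>)" "y \<in> space \<mu>" "y' \<in> space \<mu>" for k x y y'
      using up[OF that] by (simp add: c)
  qed fact
qed

text \<open>Exchange the coordinates one at a time through the hybrids \<open>w k\<close>, which
  follow \<open>z\<close> below \<open>k\<close> and \<open>x\<close> from there on. The purpose is
  boundedness of \<open>A\<close>, which makes all moments of the deviation finite.\<close>

lemma norm_diff_le_of_coordinate_sensitivity:
  fixes A :: "(nat \<Rightarrow> 'x) \<Rightarrow> 'h::real_normed_vector"
  assumes c: "\<And>k x y y'. k < n \<Longrightarrow> x \<in> space (sample_space n \<mu>) \<Longrightarrow> y \<in> space \<mu> \<Longrightarrow> y' \<in> space \<mu>
      \<Longrightarrow> norm (A (x(k := y)) - A (x(k := y'))) \<le> c"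
    and x: "x \<in> space (sample_space n \<mu>)" and z: "z \<in> space (sample_space n \<mu>)"
  shows "norm (A x - A z) \<le> real n * c"
proof -
  define w where "w = (\<lambda>k i. if i < k then z i else x i)"
  have wsp: "w k \<in> space (sample_space n \<mu>)" if "k \<le> n" for k
    using x z that by (auto simp: w_def space_PiM PiE_iff extensional_def)
  have "norm (A x - A (w k)) \<le> real k * c" if "k \<le> n" for k
    using that
  proof (induction k)
    case 0
    then show ?case by (simp add: w_def)
  next
    case (Suc k)
    have 1: "w k = (w k)(k := x k)" "w (Suc k) = (w k)(k := z k)"
      by (auto simp: w_def fun_eq_iff less_Suc_eq)
    have "norm (A ((w k)(k := x k)) - A ((w k)(k := z k))) \<le> c"
      using Suc.prems x z by (intro c wsp) (auto simp: space_PiM PiE_iff)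
    then have "norm (A (w k) - A (w (Suc k))) \<le> c"
      using 1 by metis
    moreover have "norm (A x - A (w k)) \<le> real k * c" using Suc by simp
    moreover have "norm (A x - A (w (Suc k))) \<le> norm (A x - A (w k)) + norm (A (w k) - A (w (Suc k)))"
      using norm_triangle_ineq[of "A x - A (w k)" "A (w k) - A (w (Suc k))"] by simp
    ultimately show ?case by (simp add: algebra_simps)
  qed
  moreover have "w n = z"
    using x z by (auto simp: w_def fun_eq_iff space_PiM PiE_iff extensional_def)
  ultimately show ?thesis by force
qed

text \<open>From \<open>u\<^sup>2 - v\<^sup>2 = (u - v) * (u + v) \<le> c * (2 * u)\<close> the
  self-bounding constant is \<open>4 * c\<^sup>2\<close> per coordinate, hence
  \<open>a = 4 * n * c\<^sup>2\<close> in total. The number 12 in the hypothesis is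
  \<open>3 * 4\<close>: it gives \<open>a * l0 \<le> 1 / 3\<close> at
  \<open>l0 = 1 / \<sigma>\<^sup>2\<close>.\<close>

lemma exp_square_deviation_le:
  fixes A :: "(nat \<Rightarrow> 'x) \<Rightarrow> 'h::euclidean_space"
  assumes "prob_space \<mu>" and n: "n > 0" and [measurable]: "A \<in> borel_measurable (sample_space n \<mu>)"
    and \<sigma>: "\<sigma> > 0"
    and le: "ereal (12 * real n) * (hyp_sens n \<mu> A)\<^sup>2 \<le> ereal (\<sigma>\<^sup>2)"
  defines "m \<equiv> \<integral>x. A x \<partial>sample_space n \<mu>"
  shows "(\<integral>\<^sup>+x. ennreal (exp ((norm (A x - m))\<^sup>2 / \<sigma>\<^sup>2)) \<partial>sample_space n \<mu>)
    \<le> ennreal (exp (6 / \<sigma>\<^sup>2 * alg_var n \<mu> A))"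
proof -
  interpret prob_space \<mu> by fact
  interpret P: prob_space "sample_space n \<mu>" by (intro prob_space_PiM assms(1))
  obtain c where c: "0 \<le> c" "12 * real n * c\<^sup>2 \<le> \<sigma>\<^sup>2"
    "\<And>k x y y'. k < n \<Longrightarrow> x \<in> space (sample_space n \<mu>) \<Longrightarrow> y \<in> space \<mu> \<Longrightarrow> y' \<in> space \<mu>
      \<Longrightarrow> norm (A (x(k := y)) - A (x(k := y'))) \<le> c"
    using hyp_sens_bound[OF assms(1) n le] by metis
  obtain x0 where x0: "x0 \<in> space (sample_space n \<mu>)" using P.not_empty by blast
  define R where "R = norm (A x0) + real n * c + norm m"
  have R: "norm (A x - m) \<le> R" if "x \<in> space (sample_space n \<mu>)" for x
    using norm_diff_le_of_coordinate_sensitivity[where A = A and c = c, OF c(3) that x0]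
      norm_triangle_ineq[of "A x - A x0" "A x0"] norm_triangle_ineq4[of "A x" m]
    unfolding R_def by simp
  define f where "f = (\<lambda>x. (norm (A x - m))\<^sup>2)"
  define a where "a = real n * (4 * c\<^sup>2)"
  have [measurable]: "f \<in> borel_measurable (sample_space n \<mu>)" unfolding f_def by measurable
  have f: "0 \<le> f x \<and> f x \<le> R\<^sup>2" if "x \<in> space (sample_space n \<mu>)" for x
    using R[OF that] by (auto simp: f_def intro!: power_mono)
  have self: "(f (x(i := y)) - f (x(i := z)))\<^sup>2 \<le> 4 * c\<^sup>2 * f (x(i := y))"
    if i: "i \<in> {..<n}" and x: "x \<in> space (sample_space n \<mu>)" and yz: "y \<in> space \<mu>" "z \<in> space \<mu>"
      and le: "f (x(i := z)) \<le> f (x(i := y))" for i x y z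
  proof -
    define u where "u = norm (A (x(i := y)) - m)"
    define v where "v = norm (A (x(i := z)) - m)"
    have uv: "0 \<le> v" "v \<le> u" "f (x(i := y)) = u\<^sup>2" "f (x(i := z)) = v\<^sup>2"
      using le power2_le_imp_le[of v u] by (auto simp: u_def v_def f_def)
    have "u - v \<le> norm (A (x(i := y)) - A (x(i := z)))"
      unfolding u_def v_def using norm_triangle_ineq2[of "A (x(i := y)) - m" "A (x(i := z)) - m"] by simp
    also have "\<dots> \<le> c" using i x yz by (intro c(3)) auto
    finally have uc: "u - v \<le> c" .
    have "u\<^sup>2 - v\<^sup>2 = (u - v) * (u + v)" by (simp add: power2_eq_square algebra_simps)
    also have "\<dots> \<le> c * (2 * u)" using uv uc c(1) by (intro mult_mono) auto
    finally have "(u\<^sup>2 - v\<^sup>2)\<^sup>2 \<le> (c * (2 * u))\<^sup>2" using uv by (intro power_mono) (auto intro: power_mono)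
    then show ?thesis unfolding uv by (simp add: power_mult_distrib)
  qed
  have "(\<integral>x. exp (1 / \<sigma>\<^sup>2 * f x) \<partial>sample_space n \<mu>) \<le> exp (6 * (1 / \<sigma>\<^sup>2) * (\<integral>x. f x \<partial>sample_space n \<mu>))"
  proof (rule P.exp_moment_le_of_entropy)
    show "a * (1 / \<sigma>\<^sup>2) \<le> 1 / 3" using c(2) \<sigma> by (simp add: a_def divide_simps)
    show "ent (sample_space n \<mu>) (\<lambda>x. exp (l * f x)) \<le> a * l\<^sup>2 * (\<integral>x. f x * exp (l * f x) \<partial>sample_space n \<mu>)"
      if "0 \<le> l" for l
      using self_bounding_entropy_le[where I = "{..<n}" and M = "\<lambda>_. \<mu>" and f = f and d = "4 * c\<^sup>2" and l = l, OF assms(1) _ _ f _ that self]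
      by (simp add: a_def)
  qed (use f \<sigma> in \<open>auto simp: a_def\<close>)
  moreover have "(\<integral>x. f x \<partial>sample_space n \<mu>) = alg_var n \<mu> A"
    by (simp add: alg_var_def f_def m_def)
  moreover have "integrable (sample_space n \<mu>) (\<lambda>x. exp (1 / \<sigma>\<^sup>2 * f x))"
    using f \<sigma> by (intro P.integrable_between[where a=0 and b="exp (1 / \<sigma>\<^sup>2 * R\<^sup>2)"])
      (auto intro!: divide_right_mono)
  ultimately show ?thesis
    by (simp add: f_def nn_integral_eq_integral ennreal_leI)
qed

section \<open>Change of measure and the final bound\<close>

lemma Donsker_Varadhan_le:
  fixes G :: "'h \<Rightarrow> ennreal"
  assumes "prob_space Q" "prob_space P" and sets: "sets P = sets Q"
    and [measurable]: "G \<in> borel_measurable Q" and c: "c > 0" and z: "z > 0"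
    and le: "(\<integral>\<^sup>+h. (if G h = \<top> then \<top> else ennreal (exp (c * enn2real (G h)))) \<partial>Q) \<le> ennreal z"
    and ac: "absolutely_continuous Q P"
    and int: "integrable P (\<lambda>h. ln (enn2real (RN_deriv Q P h)))"
  shows "enn2ereal (\<integral>\<^sup>+h. G h \<partial>P) \<le> ereal (((\<integral>h. ln (enn2real (RN_deriv Q P h)) \<partial>P) + ln z) / c)"
proof -
  interpret Q: prob_space Q by fact
  interpret P: prob_space P by fact
  define r where "r = (\<lambda>h. enn2real (RN_deriv Q P h))"
  define g where "g = (\<lambda>h. enn2real (G h))"
  define w where "w = (\<lambda>h. if G h = \<top> then \<top> else ennreal (exp (c * enn2real (G h))))"
  have [measurable]: "w \<in> borel_measurable Q" unfolding w_def by measurable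
  have [measurable_cong]: "sets P = sets Q" by fact
  have [measurable]: "r \<in> borel_measurable Q" "g \<in> borel_measurable Q" unfolding r_def g_def by measurable
  have PQ: "density Q (RN_deriv Q P) = P" by (rule Q.density_RN_deriv[OF ac sets])
  have finQ: "AE h in Q. RN_deriv Q P h \<noteq> \<infinity>"
    using P.sigma_finite_measure_axioms ac sets by (rule Q.RN_deriv_finite)
  have "(\<integral>\<^sup>+h. w h \<partial>Q) \<noteq> \<infinity>" using le by (auto simp: w_def top_unique)
  then have "AE h in Q. w h \<noteq> \<infinity>" by (intro nn_integral_noteq_infinite) auto
  then have "AE h in Q. G h \<noteq> \<top>" by eventually_elim (auto simp: w_def)
  then have GP: "AE h in P. G h \<noteq> \<top>" using ac sets by (intro absolutely_continuous_AE[OF sets]) auto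
  have finP: "AE h in P. RN_deriv Q P h \<noteq> \<infinity>" using finQ ac by (intro absolutely_continuous_AE[OF sets]) auto
  have "AE h in density Q (RN_deriv Q P). RN_deriv Q P h > 0"
    by (subst AE_density) auto
  then have posP: "AE h in P. RN_deriv Q P h > 0" unfolding PQ .
  have rP: "AE h in P. 0 < r h"
    using finP posP by eventually_elim (auto simp: r_def enn2real_positive_iff top.not_eq_extremum)
  \<comment> \<open>This is the ratio of the tilted measure \<open>exp (c * g) / z\<close> times
    \<open>Q\<close> to \<open>P\<close>. That its \<open>P\<close>-mean is at most one takes the
    place of nonnegativity of a relative entropy.\<close>
  define \<psi> where "\<psi> = (\<lambda>h. exp (c * g h) / (r h * z))"
  have [measurable]: "\<psi> \<in> borel_measurable Q" unfolding \<psi>_def by measurable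
  have "(\<integral>\<^sup>+h. ennreal (\<psi> h) \<partial>P) = (\<integral>\<^sup>+h. RN_deriv Q P h * ennreal (\<psi> h) \<partial>Q)"
    by (subst PQ[symmetric], subst nn_integral_density) auto
  also have "\<dots> \<le> (\<integral>\<^sup>+h. ennreal (1 / z) * w h \<partial>Q)"
  proof (rule nn_integral_mono_AE)
    show "AE h in Q. RN_deriv Q P h * ennreal (\<psi> h) \<le> ennreal (1 / z) * w h"
      using finQ
    proof eventually_elim
      case (elim h)
      then have R: "RN_deriv Q P h = ennreal (r h)"
        by (simp add: r_def top.not_eq_extremum)
      show ?case
      proof (cases "G h = \<top>")
        case True
        then show ?thesis using z by (simp add: w_def ennreal_mult_top)
      next
        case False
        \<comment> \<open>Where the density \<open>r\<close> vanishes, division by zero makes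
          \<open>\<psi>\<close> zero, so there is an inequality instead of an equality.\<close>
        have "r h * \<psi> h \<le> 1 / z * exp (c * g h)"
          using z by (cases "r h = 0") (auto simp: \<psi>_def)
        moreover have "0 \<le> r h" by (simp add: r_def)
        ultimately show ?thesis
          using False z by (simp add: R w_def g_def ennreal_mult'[symmetric] ennreal_leI)
      qed
    qed
  qed
  also have "\<dots> = ennreal (1 / z) * (\<integral>\<^sup>+h. w h \<partial>Q)" by (simp add: nn_integral_cmult)
  also have "\<dots> \<le> ennreal (1 / z) * ennreal z" using le by (intro mult_left_mono) (auto simp: w_def)
  also have "\<dots> = 1" using z by (simp add: ennreal_mult[symmetric])
  finally have \<psi>1: "(\<integral>\<^sup>+h. ennreal (\<psi> h) \<partial>P) \<le> 1" .
  have \<psi>0: "0 \<le> \<psi> h" for h using z by (simp add: \<psi>_def r_def)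
  have i\<psi>: "integrable P \<psi>"
    using \<psi>0 \<psi>1 by (intro integrableI_nonneg) (auto simp: order_le_less_trans)
  have "ennreal (\<integral>h. \<psi> h \<partial>P) \<le> 1"
    using \<psi>1 nn_integral_eq_integral[OF i\<psi>] \<psi>0 by simp
  then have I\<psi>: "(\<integral>h. \<psi> h \<partial>P) \<le> 1" by simp
  \<comment> \<open>Obtained from \<open>ln \<psi> \<le> \<psi> - 1\<close>, solved for
    \<open>g\<close>. This integrable majorant shows that \<open>G\<close> has a finite
    \<open>P\<close>-integral, which is not assumed.\<close>
  define \<phi> where "\<phi> = (\<lambda>h. (ln (r h) + ln z + \<psi> h - 1) / c)"
  have ir: "integrable P (\<lambda>h. ln (r h))" using int by (simp add: r_def)
  have i\<phi>: "integrable P \<phi>"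
    unfolding \<phi>_def using ir i\<psi> by simp
  have I\<phi>: "(\<integral>h. \<phi> h \<partial>P) \<le> ((\<integral>h. ln (r h) \<partial>P) + ln z) / c"
    unfolding \<phi>_def using ir i\<psi> I\<psi> c by (simp add: P.prob_space divide_right_mono)
  have G\<phi>: "AE h in P. G h \<le> ennreal (\<phi> h) \<and> 0 \<le> \<phi> h"
    using GP rP
  proof eventually_elim
    case (elim h)
    have "ln (\<psi> h) \<le> \<psi> h - 1" using elim z by (intro ln_le_minus_one) (auto simp: \<psi>_def)
    moreover have "ln (\<psi> h) = c * g h - (ln (r h) + ln z)"
      using elim z by (simp add: \<psi>_def ln_divide_pos ln_mult_pos)
    ultimately have "g h \<le> \<phi> h" using c by (simp add: \<phi>_def field_simps)
    moreover have "0 \<le> g h" "G h = ennreal (g h)" using elim by (auto simp: g_def top.not_eq_extremum)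
    ultimately show ?case by (auto intro: ennreal_leI)
  qed
  have "(\<integral>\<^sup>+h. G h \<partial>P) \<le> (\<integral>\<^sup>+h. ennreal (\<phi> h) \<partial>P)"
    using G\<phi> by (intro nn_integral_mono_AE) auto
  also have "\<dots> = ennreal (\<integral>h. \<phi> h \<partial>P)"
    using G\<phi> i\<phi> by (intro nn_integral_eq_integral) auto
  finally have "(\<integral>\<^sup>+h. G h \<partial>P) \<le> ennreal (\<integral>h. \<phi> h \<partial>P)" .
  moreover have "0 \<le> (\<integral>h. \<phi> h \<partial>P)" using G\<phi> by (intro integral_nonneg_AE) auto
  ultimately have "enn2ereal (\<integral>\<^sup>+h. G h \<partial>P) \<le> ereal (\<integral>h. \<phi> h \<partial>P)"
    by (metis enn2ereal_ennreal less_eq_ennreal.rep_eq)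
  also have "\<dots> \<le> ereal (((\<integral>h. ln (r h) \<partial>P) + ln z) / c)" using I\<phi> by simp
  finally show ?thesis by (simp add: r_def)
qed

lemma gauss_post_exp_kl_moment:
  fixes \<mu> :: "'x measure" and hyp :: "'h::euclidean_space \<Rightarrow> 'x \<Rightarrow> real"
    and A :: "(nat \<Rightarrow> 'x) \<Rightarrow> 'h"
  assumes "prob_space \<mu>"
    and hypm [measurable]: "(\<lambda>(h, x). hyp h x) \<in> borel_measurable (lborel \<Otimes>\<^sub>M \<mu>)"
    and hyp: "\<And>h x. x \<in> space \<mu> \<Longrightarrow> 0 \<le> hyp h x \<and> hyp h x \<le> 1"
    and Am [measurable]: "A \<in> borel_measurable (sample_space n \<mu>)"
    and \<sigma>: "\<sigma> > 0"
    and sens: "ereal (12 * real n) * (hyp_sens n \<mu> A)\<^sup>2 \<le> ereal (\<sigma>\<^sup>2)"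
    and n: "n > 0"
  shows "(\<lambda>(xs, h). exp_kl c (emp_risk n hyp h xs) (risk \<mu> hyp h))
      \<in> borel_measurable (sample_space n \<mu> \<Otimes>\<^sub>M lborel)" (is ?measurable)
    and "(\<integral>\<^sup>+xs. (\<integral>\<^sup>+h. ennreal (gauss_density \<sigma> (A xs) h)
          * exp_kl (real n / 2) (emp_risk n hyp h xs) (risk \<mu> hyp h) \<partial>lborel) \<partial>sample_space n \<mu>)
      \<le> ennreal (sqrt (2 * sqrt (real n) * exp (6 / \<sigma>\<^sup>2 * alg_var n \<mu> A)))" (is ?moment)
proof -
  interpret prob_space \<mu> by fact
  interpret S: prob_space "sample_space n \<mu>" by (intro prob_space_PiM assms(1))
  interpret SL: pair_sigma_finite "sample_space n \<mu>" "lborel :: 'h measure" ..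
  have [measurable]: "(\<lambda>h. risk \<mu> hyp h) \<in> borel_measurable lborel"
    unfolding risk_def by measurable
  have [measurable]: "(\<lambda>p. hyp (snd p) (fst p i)) \<in> borel_measurable (sample_space n \<mu> \<Otimes>\<^sub>M lborel)" if "i \<in> {..<n}" for i
  proof -
    have "(\<lambda>p. (snd p, fst p i)) \<in> measurable (sample_space n \<mu> \<Otimes>\<^sub>M lborel) (lborel \<Otimes>\<^sub>M \<mu>)"
      using that by measurable
    from measurable_compose[OF this hypm] show ?thesis by simp
  qed
  have [measurable]: "(\<lambda>p. emp_risk n hyp (snd p) (fst p)) \<in> borel_measurable (sample_space n \<mu> \<Otimes>\<^sub>M lborel)"
    unfolding emp_risk_def by measurable
  show meas: "(\<lambda>(xs, h). exp_kl c (emp_risk n hyp h xs) (risk \<mu> hyp h))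
      \<in> borel_measurable (sample_space n \<mu> \<Otimes>\<^sub>M lborel)" for c
    unfolding split_beta' by measurable
  define m where "m = (\<integral>x. A x \<partial>sample_space n \<mu>)"
  define X where "X = 2 * sqrt (real n)"
  define Y where "Y = exp (6 / \<sigma>\<^sup>2 * alg_var n \<mu> A)"
  \<comment> \<open>Minimizes \<open>t / 2 * X + Y / (2 * t)\<close>; the minimum is
    \<open>sqrt (X * Y)\<close>.\<close>
  define t where "t = sqrt (Y / X)"
  define W where "W = (\<lambda>c xs h. exp_kl c (emp_risk n hyp h xs) (risk \<mu> hyp h))"
  have XY: "X > 0" "Y > 0" "t > 0" using n by (auto simp: X_def Y_def t_def)
  have Wm [measurable]: "(\<lambda>(xs, h). W c xs h) \<in> borel_measurable (sample_space n \<mu> \<Otimes>\<^sub>M lborel)" for c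
    using meas by (simp add: W_def)
  have hm: "hyp h \<in> borel_measurable \<mu>" for h
    using measurable_compose[OF measurable_Pair1' hypm, of h] by simp
  have W1: "(\<integral>\<^sup>+xs. W (real n) xs h \<partial>sample_space n \<mu>) \<le> ennreal X" for h
    unfolding W_def emp_risk_def risk_def X_def
    using n hyp hm assms(1) by (intro nn_integral_exp_kl_le) auto
  \<comment> \<open>The Gaussian at \<open>m\<close> does not depend on the sample, so the integrals
    can be exchanged and \<open>W1\<close> used for each fixed \<open>h\<close>.\<close>
  have prior: "(\<integral>\<^sup>+xs. (\<integral>\<^sup>+h. ennreal (t / 2 * gauss_density \<sigma> m h) * W (real n) xs h \<partial>lborel) \<partial>sample_space n \<mu>)
      \<le> ennreal (t / 2) * ennreal X"
  proof -
    have "(\<integral>\<^sup>+xs. (\<integral>\<^sup>+h. ennreal (t / 2 * gauss_density \<sigma> m h) * W (real n) xs h \<partial>lborel) \<partial>sample_space n \<mu>)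
        = (\<integral>\<^sup>+h. (\<integral>\<^sup>+xs. ennreal (t / 2 * gauss_density \<sigma> m h) * W (real n) xs h \<partial>sample_space n \<mu>) \<partial>lborel)"
      by (rule SL.Fubini'[symmetric]) measurable
    also have "\<dots> = (\<integral>\<^sup>+h. ennreal (t / 2 * gauss_density \<sigma> m h) * (\<integral>\<^sup>+xs. W (real n) xs h \<partial>sample_space n \<mu>) \<partial>lborel)"
      by (intro nn_integral_cong nn_integral_cmult) measurable
    also have "\<dots> \<le> (\<integral>\<^sup>+h. (ennreal (t / 2) * ennreal X) * ennreal (gauss_density \<sigma> m h) \<partial>lborel)"
    proof (intro nn_integral_mono)
      fix h
      have "ennreal (t / 2 * gauss_density \<sigma> m h) * (\<integral>\<^sup>+xs. W (real n) xs h \<partial>sample_space n \<mu>)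
          \<le> ennreal (t / 2 * gauss_density \<sigma> m h) * ennreal X"
        by (intro mult_left_mono W1) simp
      also have "\<dots> = (ennreal (t / 2) * ennreal X) * ennreal (gauss_density \<sigma> m h)"
        using XY by (subst ennreal_mult') (auto simp: mult_ac)
      finally show "ennreal (t / 2 * gauss_density \<sigma> m h) * (\<integral>\<^sup>+xs. W (real n) xs h \<partial>sample_space n \<mu>)
          \<le> (ennreal (t / 2) * ennreal X) * ennreal (gauss_density \<sigma> m h)" .
    qed
    also have "\<dots> = ennreal (t / 2) * ennreal X"
      using \<sigma> by (subst nn_integral_cmult) (auto simp: nn_integral_gauss_density)
    finally show ?thesis .
  qed
  have chi: "(\<integral>\<^sup>+xs. (\<integral>\<^sup>+h. ennreal (1 / (2 * t)) * ennreal ((gauss_density \<sigma> (A xs) h)\<^sup>2 / gauss_density \<sigma> m h) \<partial>lborel) \<partial>sample_space n \<mu>)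
      \<le> ennreal (1 / (2 * t)) * ennreal Y"
  proof -
    have "(\<integral>\<^sup>+xs. (\<integral>\<^sup>+h. ennreal (1 / (2 * t)) * ennreal ((gauss_density \<sigma> (A xs) h)\<^sup>2 / gauss_density \<sigma> m h) \<partial>lborel) \<partial>sample_space n \<mu>)
        = (\<integral>\<^sup>+xs. ennreal (1 / (2 * t)) * ennreal (exp ((norm (A xs - m))\<^sup>2 / \<sigma>\<^sup>2)) \<partial>sample_space n \<mu>)"
      using \<sigma> by (simp add: nn_integral_cmult nn_integral_gauss_density_square_div)
    also have "\<dots> = ennreal (1 / (2 * t)) * (\<integral>\<^sup>+xs. ennreal (exp ((norm (A xs - m))\<^sup>2 / \<sigma>\<^sup>2)) \<partial>sample_space n \<mu>)"
      by (rule nn_integral_cmult) measurable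
    also have "\<dots> \<le> ennreal (1 / (2 * t)) * ennreal Y"
      unfolding m_def Y_def using exp_square_deviation_le[OF assms(1) n Am \<sigma> sens]
      by (intro mult_left_mono) auto
    finally show ?thesis .
  qed
  have "(\<integral>\<^sup>+xs. (\<integral>\<^sup>+h. ennreal (gauss_density \<sigma> (A xs) h) * W (real n / 2) xs h \<partial>lborel) \<partial>sample_space n \<mu>)
    \<le> (\<integral>\<^sup>+xs. (\<integral>\<^sup>+h. ennreal (t / 2 * gauss_density \<sigma> m h) * W (real n) xs h
        + ennreal (1 / (2 * t)) * ennreal ((gauss_density \<sigma> (A xs) h)\<^sup>2 / gauss_density \<sigma> m h) \<partial>lborel) \<partial>sample_space n \<mu>)"
    unfolding W_def using XY \<sigma>
    by (intro nn_integral_mono exp_kl_mult_le) (auto simp: gauss_density_pos less_imp_le)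
  also have "\<dots> = (\<integral>\<^sup>+xs. (\<integral>\<^sup>+h. ennreal (t / 2 * gauss_density \<sigma> m h) * W (real n) xs h \<partial>lborel)
        + (\<integral>\<^sup>+h. ennreal (1 / (2 * t)) * ennreal ((gauss_density \<sigma> (A xs) h)\<^sup>2 / gauss_density \<sigma> m h) \<partial>lborel) \<partial>sample_space n \<mu>)"
    by (intro nn_integral_cong nn_integral_add) measurable
  also have "\<dots> = (\<integral>\<^sup>+xs. (\<integral>\<^sup>+h. ennreal (t / 2 * gauss_density \<sigma> m h) * W (real n) xs h \<partial>lborel) \<partial>sample_space n \<mu>)
      + (\<integral>\<^sup>+xs. (\<integral>\<^sup>+h. ennreal (1 / (2 * t)) * ennreal ((gauss_density \<sigma> (A xs) h)\<^sup>2 / gauss_density \<sigma> m h) \<partial>lborel) \<partial>sample_space n \<mu>)"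
    by (intro nn_integral_add) measurable
  also have "\<dots> \<le> ennreal (t / 2) * ennreal X + ennreal (1 / (2 * t)) * ennreal Y"
    by (intro add_mono prior chi)
  also have "\<dots> = ennreal (t / 2 * X + 1 / (2 * t) * Y)"
    using XY by (simp add: ennreal_mult[symmetric])
  also have "t / 2 * X + 1 / (2 * t) * Y = sqrt (X * Y)"
  proof -
    have 1: "t * X = sqrt (X * Y)"
      using XY by (simp add: t_def real_sqrt_divide real_sqrt_mult field_simps)
    have 2: "Y / t = sqrt (X * Y)"
      using XY by (simp add: t_def real_sqrt_divide real_sqrt_mult field_simps)
    have "t / 2 * X + 1 / (2 * t) * Y = (t * X + Y / t) / 2" using XY by (simp add: field_simps)
    then show ?thesis unfolding 1 2 by simp
  qed
  finally show ?moment by (simp add: W_def X_def Y_def)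
qed

theorem theorem10:
  fixes \<mu> :: "'x measure" and hyp :: "'h::euclidean_space \<Rightarrow> 'x \<Rightarrow> real"
    and A :: "(nat \<Rightarrow> 'x) \<Rightarrow> 'h" and \<sigma> \<delta> :: real and n :: nat
  assumes "prob_space \<mu>"
    and "(\<lambda>(h, x). hyp h x) \<in> borel_measurable (lborel \<Otimes>\<^sub>M \<mu>)"
    and "\<And>h x. x \<in> space \<mu> \<Longrightarrow> 0 \<le> hyp h x \<and> hyp h x \<le> 1"
    and "A \<in> borel_measurable (sample_space n \<mu>)"
    and "\<sigma> > 0"
    and "ereal (12 * real n) * (hyp_sens n \<mu> A)\<^sup>2 \<le> ereal (\<sigma>\<^sup>2)"
    and "n > 8" and "\<delta> > 0"
  shows "\<exists>S\<in>sets (sample_space n \<mu>). measure (sample_space n \<mu>) S \<ge> 1 - \<delta> \<and>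
    (\<forall>xs\<in>S. \<forall>P. prob_space P \<and> sets P = sets lborel \<longrightarrow>
       enn2ereal (\<integral>\<^sup>+ h. kl (emp_risk n hyp h xs) (risk \<mu> hyp h) \<partial>P)
       \<le> (2 * KL_div P (gauss_post \<sigma> (A xs))
           + ereal (6 / \<sigma>\<^sup>2 * alg_var n \<mu> A + ln (2 * sqrt (real n)) + 2 * ln (1 / \<delta>)))
         / ereal (real n))"
proof -
  interpret prob_space \<mu> by fact
  interpret S: prob_space "sample_space n \<mu>" by (intro prob_space_PiM assms(1))
  have n: "n > 0" using assms(7) by simp
  note [measurable] = assms(2,4)
  have Wm [measurable]: "(\<lambda>(xs, h). exp_kl c (emp_risk n hyp h xs) (risk \<mu> hyp h))
      \<in> borel_measurable (sample_space n \<mu> \<Otimes>\<^sub>M lborel)" for c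
    by (rule gauss_post_exp_kl_moment(1)[OF assms(1-6) n])
  define K where "K = sqrt (2 * sqrt (real n) * exp (6 / \<sigma>\<^sup>2 * alg_var n \<mu> A))"
  define Z where "Z = (\<lambda>xs. \<integral>\<^sup>+h. ennreal (gauss_density \<sigma> (A xs) h)
          * exp_kl (real n / 2) (emp_risk n hyp h xs) (risk \<mu> hyp h) \<partial>lborel)"
  have K: "K > 0" using n by (simp add: K_def)
  have [measurable]: "Z \<in> borel_measurable (sample_space n \<mu>)" unfolding Z_def by measurable
  have EZ: "(\<integral>\<^sup>+xs. Z xs \<partial>sample_space n \<mu>) \<le> ennreal K"
    unfolding Z_def K_def by (rule gauss_post_exp_kl_moment(2)[OF assms(1-6) n])
  \<comment> \<open>The bad event of Markov's inequality. It is determined by the sample alone, so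
    its complement serves all \<open>P\<close> at once.\<close>
  define T where "T = {xs \<in> space (sample_space n \<mu>). 1 \<le> ennreal (\<delta> / K) * Z xs}"
  have [measurable]: "T \<in> sets (sample_space n \<mu>)" unfolding T_def by measurable
  have "emeasure (sample_space n \<mu>) T \<le> ennreal (\<delta> / K) * (\<integral>\<^sup>+xs. Z xs \<partial>sample_space n \<mu>)"
    unfolding T_def
    using nn_integral_Markov_inequality[of Z "space (sample_space n \<mu>)" "sample_space n \<mu>" "ennreal (\<delta> / K)"]
    by (simp cong: nn_integral_cong)
  also have "\<dots> \<le> ennreal (\<delta> / K) * ennreal K" using EZ by (intro mult_left_mono) auto
  also have "\<dots> = ennreal \<delta>" using K assms(8) by (simp add: ennreal_mult[symmetric])
  finally have "measure (sample_space n \<mu>) T \<le> \<delta>"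
    using assms(8) by (simp add: S.emeasure_eq_measure)
  then have prob: "1 - \<delta> \<le> measure (sample_space n \<mu>) (space (sample_space n \<mu>) - T)"
    by (simp add: S.prob_compl)
  show ?thesis
  proof (intro bexI[of _ "space (sample_space n \<mu>) - T"] conjI prob ballI allI impI)
    fix xs P assume xs: "xs \<in> space (sample_space n \<mu>) - T" and P: "prob_space P \<and> sets P = sets (lborel :: 'h measure)"
    define Q where "Q = gauss_post \<sigma> (A xs)"
    define V where "V = 6 / \<sigma>\<^sup>2 * alg_var n \<mu> A + ln (2 * sqrt (real n)) + 2 * ln (1 / \<delta>)"
    define G where "G = (\<lambda>h. kl (emp_risk n hyp h xs) (risk \<mu> hyp h))"
    have sQ [measurable_cong]: "sets Q = sets lborel" by (simp add: Q_def gauss_post_eq)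
    show "enn2ereal (\<integral>\<^sup>+ h. kl (emp_risk n hyp h xs) (risk \<mu> hyp h) \<partial>P)
       \<le> (2 * KL_div P (gauss_post \<sigma> (A xs))
           + ereal (6 / \<sigma>\<^sup>2 * alg_var n \<mu> A + ln (2 * sqrt (real n)) + 2 * ln (1 / \<delta>)))
         / ereal (real n)"
      unfolding Q_def[symmetric] V_def[symmetric] G_def[symmetric]
    proof (cases "absolutely_continuous Q P \<and> integrable P (\<lambda>h. ln (enn2real (RN_deriv Q P h)))")
      case False
      then have "KL_div P Q = \<infinity>" by (simp add: KL_div_def)
      then show "enn2ereal (\<integral>\<^sup>+ h. G h \<partial>P) \<le> (2 * KL_div P Q + ereal V) / ereal (real n)"
        using n by simp
    next
      case True
      define L where "L = (\<integral>h. ln (enn2real (RN_deriv Q P h)) \<partial>P)"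
      have KL: "KL_div P Q = ereal L" using True by (simp add: KL_div_def L_def)
      have em: "(\<lambda>h. hyp h (xs i)) \<in> borel_measurable lborel" if "i < n" for i
      proof -
        have "xs i \<in> space \<mu>" using xs that by (auto simp: space_PiM PiE_iff)
        then have "(\<lambda>h. (h, xs i)) \<in> measurable lborel (lborel \<Otimes>\<^sub>M \<mu>)" by simp
        from measurable_compose[OF this assms(2)] show ?thesis by simp
      qed
      have [measurable]: "(\<lambda>h. emp_risk n hyp h xs) \<in> borel_measurable lborel"
        unfolding emp_risk_def using em by measurable
      have [measurable]: "(\<lambda>h. risk \<mu> hyp h) \<in> borel_measurable lborel"
        unfolding risk_def by measurable
      have "\<not> 1 \<le> ennreal (\<delta> / K) * Z xs" using xs by (auto simp: T_def)
      then have "ennreal (K / \<delta>) * (ennreal (\<delta> / K) * Z xs) \<le> ennreal (K / \<delta>) * 1"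
        by (intro mult_left_mono) auto
      moreover have "ennreal (K / \<delta>) * ennreal (\<delta> / K) = 1"
        using K assms(8) by (simp add: ennreal_mult[symmetric])
      ultimately have Zle: "Z xs \<le> ennreal (K / \<delta>)"
        by (simp add: mult.assoc[symmetric])
      have "(\<integral>\<^sup>+h. (if G h = \<top> then \<top> else ennreal (exp (real n / 2 * enn2real (G h)))) \<partial>Q) = Z xs"
        unfolding Q_def gauss_post_eq Z_def G_def exp_kl_def[symmetric]
        by (subst nn_integral_density) auto
      then have "enn2ereal (\<integral>\<^sup>+h. G h \<partial>P) \<le> ereal ((L + ln (K / \<delta>)) / (real n / 2))"
        unfolding L_def
        using P True sQ n K assms(5,8) Zle
        by (intro Donsker_Varadhan_le) (auto simp: Q_def prob_space_gauss_post G_def)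
      also have "(L + ln (K / \<delta>)) / (real n / 2) = (2 * L + V) / real n"
      proof -
        have "ln K = (ln (2 * sqrt (real n)) + 6 / \<sigma>\<^sup>2 * alg_var n \<mu> A) / 2"
          using n by (simp add: K_def ln_sqrt ln_mult_pos)
        moreover have "ln (K / \<delta>) = ln K + ln (1 / \<delta>)"
          using K assms(8) by (simp add: ln_divide_pos)
        ultimately have "2 * ln (K / \<delta>) = V" by (simp add: V_def)
        then show ?thesis using n by (simp add: field_simps)
      qed
      finally show "enn2ereal (\<integral>\<^sup>+ h. G h \<partial>P) \<le> (2 * KL_div P Q + ereal V) / ereal (real n)"
        using n by (simp add: KL)
    qed
  qed measurable
qed

end
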